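(* Let $(G,S,\alpha,h)$ satisfy condition (C), let $(G,* )$ be the groupoid obtained from $(G,\cdot)$ by the cyclic construction, let $A=\langle h\rangle$ be the subloop of $S$ generated by $h$, and let $Q=(G,\cdot)/A=(G,* )/A$. Let $\iota:Q\to\operatorname{Aut}A$ be the trivial homomorphism. Let $\pi:Q\to G$ be a transversal (i.e. $\pi(xA)\in xA$ for all $x\in G$) with $\pi(A)=1$, and for $x,y\in G$ let $\tau(xA,yA)$ be an integer with $\pi((xy)A)=\pi(xA)\pi(yA)h^{\tau(xA,yA)}$. Define $\eta,\eta^*:Q\times Q\to A$ by $$\eta(xA,yA)=h^{-\tau(xA,yA)},\qquad \eta^*(xA,yA)=\eta(xA,yA)\,h^{\sigma(i+j)}\quad (x\in\alpha^i,\ y\in\alpha^j,\ i,j\in M).$$ Then the Moufang factor sets $(\iota,\eta)$ and $(\iota,\eta^* )$ differ by an associative factor set $(\iota,\mu)$ (that is, $\eta^*=\eta+\mu$, written additively in $A$) which satisfies $$\mu\big((u\cdot vw)^{-1},\,uv\cdot w\big)=\mu\big(u\cdot vw,\,(u\cdot vw)^{-1}\big)^{\iota(uv\cdot w)}\quad\text{for all }u,v,w\in Q.$$ Consequently: $(G,* )$ is a Moufang loop; the associators in $(G,\cdot)$ and $(G,* )$ coincide (for all $x,y,z\in G$ the associator $[x,y,z]$ computed in $(G,\cdot)$ equals the one computed in $(G,* )$); the associator subloops $A(G,\cdot)$ and $A(G,* )$ coincide as loops (same set and same multiplication); and the nuclei $N(G,\cdot)$ and $N(G,* )$ coincide as 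sets.
   Context: A Moufang loop is a loop satisfying $((xy)x)z=x(y(xz))$. In a loop, the associator $[x,y,z]$ is the unique $w$ with $(xy)z=(x(yz))w$ and the commutator $[x,y]$ is the unique $w$ with $xy=(yx)w$. For a Moufang loop $G$: $N(G)=\{x:[x,y,z]=1\ \forall y,z\}$ (nucleus), $Z(G)=\{x:[x,y]=[x,y,z]=1\ \forall y,z\}$ (center). The associator subloop $A(L)$ of a loop $L$ is the subloop generated by all associators. Let $m\ge 1$ be an integer and $M=\{-m+1,-m+2,\dots,m\}$. Define $\sigma:\mathbb Z\to\{-1,0,1\}$ by $\sigma(i)=1$ if $i>m$, $\sigma(i)=0$ if $i\in M$, $\sigma(i)=-1$ if $i<1-m$. Condition (C) for $(G,S,\alpha,h)$: $G$ is a Moufang loop; $S\unlhd G$ and $G/S=\langle\alpha\rangle$ is a cyclic group of order $2m$; $1\ne h\in S\cap Z(G)$. Then $G$ is the disjoint union of the cosets $\alpha^i$, $i\in M$, and the cyclic construction defines $x*y=xy\,h^{\sigma(i+j)}$ for $x\in\alpha^i$, $y\in\alpha^j$, $i,j\in M$. The subloop $A=\langle h\rangle$ is normal in both $(G,\cdot)$ and $(G,* )$, and the two quotients are equal. Factor sets: let $Q$ be a Moufang loop, $A$ an abelian group (written additively in the definitions below), $\varphi:Q\to\operatorname{Aut}A$ a homomorphism acting on the right, $a\mapsto a^{\varphi(x)}$, and $\eta:Q\times Q\to A$. The pair $(\varphi,\eta)$ is a factor set if $\eta(x,1)=\eta(1,x)=0$ for all $x\in Q$. It is associative if $\eta(x,y)^{\varphi(z)}+\eta(xy,z)=\eta(y,z)+\eta(x,yz)$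 for all $x,y,z\in Q$, and Moufang if $\eta(x,y)^{\varphi(xz)}+\eta(xy,x)^{\varphi(z)}+\eta(xy\cdot x,z)=\eta(x,z)+\eta(y,xz)+\eta(x,y\cdot xz)$ for all $x,y,z\in Q$. The sum of factor sets is $(\varphi,\eta)+(\varphi,\mu)=(\varphi,\eta+\mu)$ with pointwise addition. In the claim the group $A=\langle h\rangle$ is written multiplicatively. The notation $u\cdot vw$ means $u(vw)$, and $uv\cdot w$ means $(uv)w$. *)

theory Defs
  imports "HOL-Algebra.Bij" "HOL-Algebra.Generated_Groups"
begin

text \<open>
  Loops are represented by the record type for monoids of HOL-Algebra, so that the definitions
  made there for arbitrary such records (cosets, set multiplication, \<^const>\<open>FactGroup\<close>,
  integer powers, inverses, \<^const>\<open>order\<close>) are available.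
\<close>

locale loop =
  fixes G (structure)
  assumes mult_closed: "\<lbrakk>x \<in> carrier G; y \<in> carrier G\<rbrakk> \<Longrightarrow> x \<otimes> y \<in> carrier G"
    and one_in_carrier: "\<one> \<in> carrier G"
    and one_mult: "x \<in> carrier G \<Longrightarrow> \<one> \<otimes> x = x"
    and mult_one: "x \<in> carrier G \<Longrightarrow> x \<otimes> \<one> = x"
    and left_division:
      "\<lbrakk>a \<in> carrier G; b \<in> carrier G\<rbrakk> \<Longrightarrow> \<exists>!x. x \<in> carrier G \<and> a \<otimes> x = b"
    and right_division:
      "\<lbrakk>a \<in> carrier G; b \<in> carrier G\<rbrakk> \<Longrightarrow> \<exists>!x. x \<in> carrier G \<and> x \<otimes> a = b"

locale moufang_loop = loop +
  assumes moufang: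
    "\<lbrakk>x \<in> carrier G; y \<in> carrier G; z \<in> carrier G\<rbrakk>
      \<Longrightarrow> ((x \<otimes> y) \<otimes> x) \<otimes> z = x \<otimes> (y \<otimes> (x \<otimes> z))"

definition associator :: "('a, 'b) monoid_scheme \<Rightarrow> 'a \<Rightarrow> 'a \<Rightarrow> 'a \<Rightarrow> 'a" where
  "associator G x y z =
    (THE w. w \<in> carrier G \<and> (x \<otimes>\<^bsub>G\<^esub> y) \<otimes>\<^bsub>G\<^esub> z = (x \<otimes>\<^bsub>G\<^esub> (y \<otimes>\<^bsub>G\<^esub> z)) \<otimes>\<^bsub>G\<^esub> w)"

definition commutator :: "('a, 'b) monoid_scheme \<Rightarrow> 'a \<Rightarrow> 'a \<Rightarrow> 'a" where
  "commutator G x y = (THE w. w \<in> carrier G \<and> x \<otimes>\<^bsub>G\<^esub> y = (y \<otimes>\<^bsub>G\<^esub> x) \<otimes>\<^bsub>G\<^esub> w)"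

definition nucleus :: "('a, 'b) monoid_scheme \<Rightarrow> 'a set" where
  "nucleus G = {x \<in> carrier G. \<forall>y\<in>carrier G. \<forall>z\<in>carrier G. associator G x y z = \<one>\<^bsub>G\<^esub>}"

definition loop_center :: "('a, 'b) monoid_scheme \<Rightarrow> 'a set" where
  "loop_center G = {x \<in> carrier G. \<forall>y\<in>carrier G. \<forall>z\<in>carrier G.
     commutator G x y = \<one>\<^bsub>G\<^esub> \<and> associator G x y z = \<one>\<^bsub>G\<^esub>}"

text \<open>A subloop is closed under multiplication and under both divisions.\<close>

definition subloop :: "'a set \<Rightarrow> ('a, 'b) monoid_scheme \<Rightarrow> bool" where
  "subloop H G \<longleftrightarrow> H \<subseteq> carrier G \<and> \<one>\<^bsub>G\<^esub> \<in> H \<and>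
     (\<forall>x\<in>H. \<forall>y\<in>H. x \<otimes>\<^bsub>G\<^esub> y \<in> H) \<and>
     (\<forall>x\<in>H. \<forall>z\<in>carrier G. x \<otimes>\<^bsub>G\<^esub> z \<in> H \<longrightarrow> z \<in> H) \<and>
     (\<forall>x\<in>H. \<forall>z\<in>carrier G. z \<otimes>\<^bsub>G\<^esub> x \<in> H \<longrightarrow> z \<in> H)"

definition subloop_generated_by :: "('a, 'b) monoid_scheme \<Rightarrow> 'a set \<Rightarrow> 'a set" where
  "subloop_generated_by G X = \<Inter>{H. subloop H G \<and> X \<subseteq> H}"

text \<open>
  If \<^term>\<open>H\<close> is normal in the loop \<^term>\<open>G\<close> in the following sense, then \<^term>\<open>G Mod H\<close>
  (whose elements are the cosets of \<^term>\<open>H\<close> and whose product is elementwise) is the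
  quotient loop.
\<close>

definition normal_subloop :: "'a set \<Rightarrow> ('a, 'b) monoid_scheme \<Rightarrow> bool" where
  "normal_subloop H G \<longleftrightarrow> subloop H G \<and>
     (\<forall>x\<in>carrier G. x <#\<^bsub>G\<^esub> H = H #>\<^bsub>G\<^esub> x) \<and>
     (\<forall>x\<in>carrier G. \<forall>y\<in>carrier G. x <#\<^bsub>G\<^esub> (y <#\<^bsub>G\<^esub> H) = (x \<otimes>\<^bsub>G\<^esub> y) <#\<^bsub>G\<^esub> H) \<and>
     (\<forall>x\<in>carrier G. \<forall>y\<in>carrier G. (H #>\<^bsub>G\<^esub> x) #>\<^bsub>G\<^esub> y = H #>\<^bsub>G\<^esub> (x \<otimes>\<^bsub>G\<^esub> y))"

definition associator_subloop :: "('a, 'b) monoid_scheme \<Rightarrow> 'a set" where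
  "associator_subloop G = subloop_generated_by G
     {associator G x y z | x y z. x \<in> carrier G \<and> y \<in> carrier G \<and> z \<in> carrier G}"

definition exponents :: "nat \<Rightarrow> int set" where
  "exponents m = {- int m + 1 .. int m}"

definition sigma :: "nat \<Rightarrow> int \<Rightarrow> int" where
  "sigma m i = (if i > int m then 1 else if i < 1 - int m then - 1 else 0)"

definition condition_C ::
    "('a, 'b) monoid_scheme \<Rightarrow> 'a set \<Rightarrow> nat \<Rightarrow> 'a set \<Rightarrow> 'a \<Rightarrow> bool" where
  "condition_C G S m \<alpha> h \<longleftrightarrow> m \<ge> 1 \<and> moufang_loop G \<and> normal_subloop S G \<and>
     group (G Mod S) \<and> \<alpha> \<in> carrier (G Mod S) \<and>
     carrier (G Mod S) = generate (G Mod S) {\<alpha>} \<and> order (G Mod S) = 2 * m \<and>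
     h \<in> S \<inter> loop_center G \<and> h \<noteq> \<one>\<^bsub>G\<^esub>"

text \<open>Under \<^const>\<open>condition_C\<close>, every \<^term>\<open>x\<close> lies in exactly one of the cosets
  \<open>\<alpha>\<^sup>i\<close> with \<open>i\<close> in \<^term>\<open>exponents m\<close>.\<close>

definition coset_exponent ::
    "('a, 'b) monoid_scheme \<Rightarrow> 'a set \<Rightarrow> nat \<Rightarrow> 'a set \<Rightarrow> 'a \<Rightarrow> int" where
  "coset_exponent G S m \<alpha> x = (THE i. i \<in> exponents m \<and> x \<in> \<alpha> [^]\<^bsub>G Mod S\<^esub> i)"

definition cyclic_construction ::
    "('a, 'b) monoid_scheme \<Rightarrow> 'a set \<Rightarrow> nat \<Rightarrow> 'a set \<Rightarrow> 'a \<Rightarrow> ('a, 'b) monoid_scheme" where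
  "cyclic_construction G S m \<alpha> h = G\<lparr>mult := \<lambda>x y. (x \<otimes>\<^bsub>G\<^esub> y) \<otimes>\<^bsub>G\<^esub>
     (h [^]\<^bsub>G\<^esub> sigma m (coset_exponent G S m \<alpha> x + coset_exponent G S m \<alpha> y))\<rparr>"

text \<open>
  The abelian group \<^term>\<open>A\<close> is written multiplicatively here. The group acts on the right,
  \<open>a\<^bsup>\<phi>(x)\<^esup>\<close> being \<open>\<phi> x a\<close>, whereas the product \<open>g \<otimes> f\<close> in \<^term>\<open>AutoGroup A\<close> is the
  composite \<open>g \<circ> f\<close>; hence the reversed order of the factors in \<open>action_mult\<close>.
\<close>

locale factor_set =
  fixes Q :: "('q, 'b) monoid_scheme" and A :: "('a, 'c) monoid_scheme"
    and \<phi> :: "'q \<Rightarrow> 'a \<Rightarrow> 'a" and \<eta> :: "'q \<Rightarrow> 'q \<Rightarrow> 'a"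
  assumes moufang_loop_Q: "moufang_loop Q"
    and comm_group_A: "comm_group A"
    and action_closed: "x \<in> carrier Q \<Longrightarrow> \<phi> x \<in> carrier (AutoGroup A)"
    and action_mult: "\<lbrakk>x \<in> carrier Q; y \<in> carrier Q\<rbrakk>
      \<Longrightarrow> \<phi> (x \<otimes>\<^bsub>Q\<^esub> y) = \<phi> y \<otimes>\<^bsub>AutoGroup A\<^esub> \<phi> x"
    and cocycle_closed: "\<lbrakk>x \<in> carrier Q; y \<in> carrier Q\<rbrakk> \<Longrightarrow> \<eta> x y \<in> carrier A"
    and cocycle_one_right: "x \<in> carrier Q \<Longrightarrow> \<eta> x \<one>\<^bsub>Q\<^esub> = \<one>\<^bsub>A\<^esub>"
    and cocycle_one_left: "x \<in> carrier Q \<Longrightarrow> \<eta> \<one>\<^bsub>Q\<^esub> x = \<one>\<^bsub>A\<^esub>"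

locale associative_factor_set = factor_set +
  assumes associative_cocycle: "\<lbrakk>x \<in> carrier Q; y \<in> carrier Q; z \<in> carrier Q\<rbrakk> \<Longrightarrow>
    \<phi> z (\<eta> x y) \<otimes>\<^bsub>A\<^esub> \<eta> (x \<otimes>\<^bsub>Q\<^esub> y) z = \<eta> y z \<otimes>\<^bsub>A\<^esub> \<eta> x (y \<otimes>\<^bsub>Q\<^esub> z)"

locale moufang_factor_set = factor_set +
  assumes moufang_cocycle: "\<lbrakk>x \<in> carrier Q; y \<in> carrier Q; z \<in> carrier Q\<rbrakk> \<Longrightarrow>
    \<phi> (x \<otimes>\<^bsub>Q\<^esub> z) (\<eta> x y) \<otimes>\<^bsub>A\<^esub> \<phi> z (\<eta> (x \<otimes>\<^bsub>Q\<^esub> y) x) \<otimes>\<^bsub>A\<^esub> \<eta> ((x \<otimes>\<^bsub>Q\<^esub> y) \<otimes>\<^bsub>Q\<^esub> x) z =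
    \<eta> x z \<otimes>\<^bsub>A\<^esub> \<eta> y (x \<otimes>\<^bsub>Q\<^esub> z) \<otimes>\<^bsub>A\<^esub> \<eta> x (y \<otimes>\<^bsub>Q\<^esub> (x \<otimes>\<^bsub>Q\<^esub> z))"

definition cocycle_sum ::
    "('a, 'c) monoid_scheme \<Rightarrow> ('q \<Rightarrow> 'q \<Rightarrow> 'a) \<Rightarrow> ('q \<Rightarrow> 'q \<Rightarrow> 'a) \<Rightarrow> 'q \<Rightarrow> 'q \<Rightarrow> 'a" where
  "cocycle_sum A \<eta> \<mu> = (\<lambda>x y. \<eta> x y \<otimes>\<^bsub>A\<^esub> \<mu> x y)"

definition trivial_action :: "('a, 'c) monoid_scheme \<Rightarrow> 'q \<Rightarrow> 'a \<Rightarrow> 'a" where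
  "trivial_action A = (\<lambda>x. \<one>\<^bsub>AutoGroup A\<^esub>)"

end

theory Submission
  imports Defs "HOL-Algebra.Multiplicative_Group"
begin

text \<open>
  Write \<open>e x\<close> for the exponent of the coset of \<open>x\<close>. The integer \<open>\<sigma>(e x + e y)\<close> is the carry of
  the addition modulo \<open>2m\<close>: \<open>2m \<sigma>(e x + e y) = e x + e y - e (x y)\<close>. So \<open>2m \<sigma>\<close> is a coboundary,
  and summing it over the steps of a word telescopes: it yields the sum of the exponents of the
  letters minus the exponent of the product. As the exponent does not depend on the bracketing,
  any two bracketings of a word acquire the same power of the central element \<open>h\<close> when \<open>*\<close>
  replaces the given product. This gives the cocycle identities, the Moufang law for \<open>*\<close> and, as
  associators have exponent 0, the equality of associators.
\<close>

section \<open>Loops and Moufang loops\<close>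

text \<open>The element \<open>h\<close> may have finite order, even one that is not prime to 2m, so
  dividing by 2m is not possible among its powers. All carry identities are therefore proved for
  integers, where 2m cancels, and only then used as exponents of \<open>h\<close>. As
  \<open>G\<close> is not associative, two things that are free in a group need an argument. The
  center is defined by conditions with the central element in first position only; the inverse
  property of Moufang loops yields the other positions, so that powers of \<open>h\<close> can be
  moved to the end of any word. Laws of exponents are obtained by viewing the center as a
  commutative group. The second tool besides the carry is that a factor in \<open>S\<close> causes
  no carry at all. Hence whatever is tested by products with a factor in \<open>S\<close> is the
  same for both products: associator equations, subloops contained in \<open>S\<close>, cosets of
  \<open>A\<close>. Since \<open>A\<close> lies in \<open>S\<close>, exponents also make sense on
  the quotient by \<open>A\<close>, which is where the factor sets live.\<close>

lemma
  fixes G (structure)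
  assumes "subloop H G"
  shows subloop_subset: "H \<subseteq> carrier G"
    and subloop_one: "\<one> \<in> H"
    and subloop_mult: "\<lbrakk>x \<in> H; y \<in> H\<rbrakk> \<Longrightarrow> x \<otimes> y \<in> H"
    and subloop_left_quotient: "\<lbrakk>x \<in> H; z \<in> carrier G; x \<otimes> z \<in> H\<rbrakk> \<Longrightarrow> z \<in> H"
    and subloop_right_quotient: "\<lbrakk>x \<in> H; z \<in> carrier G; z \<otimes> x \<in> H\<rbrakk> \<Longrightarrow> z \<in> H"
  using assms unfolding subloop_def by blast+

context loop
begin

declare mult_closed [simp] one_in_carrier [simp] one_mult [simp] mult_one [simp]

lemma left_cancel [simp]:
  assumes "a \<in> carrier G" "x \<in> carrier G" "y \<in> carrier G"
  shows "a \<otimes> x = a \<otimes> y \<longleftrightarrow> x = y"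
proof
  assume "a \<otimes> x = a \<otimes> y"
  with left_division[OF assms(1) mult_closed[OF assms(1,2)]] assms show "x = y"
    by (auto elim!: ex1E)
qed simp

lemma right_cancel [simp]:
  assumes "a \<in> carrier G" "x \<in> carrier G" "y \<in> carrier G"
  shows "x \<otimes> a = y \<otimes> a \<longleftrightarrow> x = y"
proof
  assume "x \<otimes> a = y \<otimes> a"
  with right_division[OF assms(1) mult_closed[OF assms(2,1)]] assms show "x = y"
    by (auto elim!: ex1E)
qed simp

lemma left_quotient_exists:
  "\<lbrakk>a \<in> carrier G; b \<in> carrier G\<rbrakk> \<Longrightarrow> \<exists>x\<in>carrier G. a \<otimes> x = b"
  using left_division[of a b] by blast

lemma right_quotient_exists:
  "\<lbrakk>a \<in> carrier G; b \<in> carrier G\<rbrakk> \<Longrightarrow> \<exists>x\<in>carrier G. x \<otimes> a = b"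
  using right_division[of a b] by blast

lemma associator_eqI:
  assumes "x \<in> carrier G" "y \<in> carrier G" "z \<in> carrier G" "w \<in> carrier G"
    and "(x \<otimes> y) \<otimes> z = (x \<otimes> (y \<otimes> z)) \<otimes> w"
  shows "associator G x y z = w"
  unfolding associator_def using assms by (intro the_equality) auto

lemma associator:
  assumes "x \<in> carrier G" "y \<in> carrier G" "z \<in> carrier G"
  shows associator_closed [simp]: "associator G x y z \<in> carrier G"
    and mult_associator: "(x \<otimes> y) \<otimes> z = (x \<otimes> (y \<otimes> z)) \<otimes> associator G x y z"
proof -
  obtain w where w: "w \<in> carrier G" "(x \<otimes> (y \<otimes> z)) \<otimes> w = (x \<otimes> y) \<otimes> z"
    using left_quotient_exists[of "x \<otimes> (y \<otimes> z)" "(x \<otimes> y) \<otimes> z"] assms by auto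
  have "associator G x y z = w"
    using assms w by (intro associator_eqI) auto
  with w show "associator G x y z \<in> carrier G"
    and "(x \<otimes> y) \<otimes> z = (x \<otimes> (y \<otimes> z)) \<otimes> associator G x y z" by auto
qed

lemma associator_eq_one_iff:
  assumes "x \<in> carrier G" "y \<in> carrier G" "z \<in> carrier G"
  shows "associator G x y z = \<one> \<longleftrightarrow> (x \<otimes> y) \<otimes> z = x \<otimes> (y \<otimes> z)"
proof
  show "(x \<otimes> y) \<otimes> z = x \<otimes> (y \<otimes> z)" if "associator G x y z = \<one>"
    using mult_associator[OF assms] assms by (simp add: that)
  show "associator G x y z = \<one>" if "(x \<otimes> y) \<otimes> z = x \<otimes> (y \<otimes> z)"
    using assms by (intro associator_eqI) (simp_all add: that)
qed

lemma commutator_eq_one_iff: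
  assumes "x \<in> carrier G" "y \<in> carrier G"
  shows "commutator G x y = \<one> \<longleftrightarrow> x \<otimes> y = y \<otimes> x"
proof -
  obtain w where w: "w \<in> carrier G" "(y \<otimes> x) \<otimes> w = x \<otimes> y"
    using left_quotient_exists[of "y \<otimes> x" "x \<otimes> y"] assms by auto
  have comm: "commutator G x y = w"
    unfolding commutator_def
  proof (rule the_equality)
    show "u = w" if "u \<in> carrier G \<and> x \<otimes> y = (y \<otimes> x) \<otimes> u" for u
      using that left_cancel[of "y \<otimes> x" u w] assms w by simp
  qed (simp add: w)
  have "w = \<one> \<longleftrightarrow> (y \<otimes> x) \<otimes> w = (y \<otimes> x) \<otimes> \<one>"
    by (rule left_cancel[symmetric]) (use w(1) assms in simp_all)
  then show ?thesis
    using assms by (simp add: comm w(2))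
qed

lemma loop_center_iff:
  "c \<in> loop_center G \<longleftrightarrow> c \<in> carrier G \<and>
     (\<forall>y\<in>carrier G. \<forall>z\<in>carrier G. c \<otimes> y = y \<otimes> c \<and> (c \<otimes> y) \<otimes> z = c \<otimes> (y \<otimes> z))"
proof -
  have "(commutator G c y = \<one> \<and> associator G c y z = \<one>) \<longleftrightarrow>
      c \<otimes> y = y \<otimes> c \<and> (c \<otimes> y) \<otimes> z = c \<otimes> (y \<otimes> z)"
    if "c \<in> carrier G" "y \<in> carrier G" "z \<in> carrier G" for y z
    unfolding commutator_eq_one_iff[OF that(1,2)] associator_eq_one_iff[OF that] by (rule refl)
  then show ?thesis
    unfolding loop_center_def mem_Collect_eq
    by (intro conj_cong[OF refl] ball_cong[OF refl])
qed

end

text \<open>\<open>subloop\<close> only tests products and divisions in which one factor lies in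
  \<open>H\<close>, so agreement of the two products there is enough. It will serve in both
  directions between \<open>G\<close> and \<open>Gs\<close>.\<close>

lemma subloop_transfer:
  assumes H: "subloop H L" and eq: "carrier L' = carrier L" "\<one>\<^bsub>L'\<^esub> = \<one>\<^bsub>L\<^esub>"
    and left: "\<And>x z. \<lbrakk>x \<in> H; z \<in> carrier L\<rbrakk> \<Longrightarrow> x \<otimes>\<^bsub>L'\<^esub> z = x \<otimes>\<^bsub>L\<^esub> z"
    and right: "\<And>x z. \<lbrakk>x \<in> H; z \<in> carrier L\<rbrakk> \<Longrightarrow> z \<otimes>\<^bsub>L'\<^esub> x = z \<otimes>\<^bsub>L\<^esub> x"
  shows "subloop H L'"
  unfolding subloop_def[of H L'] eq
proof (intro conjI ballI impI)
  show "H \<subseteq> carrier L" "\<one>\<^bsub>L\<^esub> \<in> H"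
    using subloop_subset[OF H] subloop_one[OF H] .
  fix x assume x: "x \<in> H"
  show "x \<otimes>\<^bsub>L'\<^esub> y \<in> H" if y: "y \<in> H" for y
    unfolding left[OF x subsetD[OF subloop_subset[OF H] y]] by (rule subloop_mult[OF H x y])
  fix z assume z: "z \<in> carrier L"
  show "z \<in> H" if "x \<otimes>\<^bsub>L'\<^esub> z \<in> H"
    using that unfolding left[OF x z] by (rule subloop_left_quotient[OF H x z])
  show "z \<in> H" if "z \<otimes>\<^bsub>L'\<^esub> x \<in> H"
    using that unfolding right[OF x z] by (rule subloop_right_quotient[OF H x z])
qed

lemma subloop_generated_by_least:
  "\<lbrakk>subloop H G; X \<subseteq> H\<rbrakk> \<Longrightarrow> subloop_generated_by G X \<subseteq> H"
  unfolding subloop_generated_by_def by blast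

lemma subset_subloop_generated_by: "X \<subseteq> subloop_generated_by G X"
  unfolding subloop_generated_by_def by blast

lemma subloop_generated_byI:
  "(\<And>H. \<lbrakk>subloop H G; X \<subseteq> H\<rbrakk> \<Longrightarrow> x \<in> H) \<Longrightarrow> x \<in> subloop_generated_by G X"
  unfolding subloop_generated_by_def by blast

lemma (in loop) subloop_generated_by_subloop:
  assumes "X \<subseteq> carrier G"
  shows "subloop (subloop_generated_by G X) G"
proof -
  have "subloop (carrier G) G"
    unfolding subloop_def by simp
  then have subset: "subloop_generated_by G X \<subseteq> carrier G"
    using assms by (rule subloop_generated_by_least)
  note least = subloop_generated_by_least[THEN subsetD]
  show ?thesis
    unfolding subloop_def[of "subloop_generated_by G X"]
  proof (intro conjI ballI impI subset)
    show "\<one> \<in> subloop_generated_by G X"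
      by (rule subloop_generated_byI) (rule subloop_one)
    fix x assume x: "x \<in> subloop_generated_by G X"
    show "x \<otimes> y \<in> subloop_generated_by G X" if "y \<in> subloop_generated_by G X" for y
      by (rule subloop_generated_byI) (intro subloop_mult least[OF _ _ x] least[OF _ _ that])
    fix z assume z: "z \<in> carrier G"
    show "z \<in> subloop_generated_by G X" if "x \<otimes> z \<in> subloop_generated_by G X"
      by (rule subloop_generated_byI)
        (rule subloop_left_quotient[OF _ least[OF _ _ x] z least[OF _ _ that]])
    show "z \<in> subloop_generated_by G X" if "z \<otimes> x \<in> subloop_generated_by G X"
      by (rule subloop_generated_byI)
        (rule subloop_right_quotient[OF _ least[OF _ _ x] z least[OF _ _ that]])
  qed
qed

lemma moufang_loopI:
  fixes G (structure)
  assumes "loop G"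
    and "\<And>x y z. \<lbrakk>x \<in> carrier G; y \<in> carrier G; z \<in> carrier G\<rbrakk>
      \<Longrightarrow> ((x \<otimes> y) \<otimes> x) \<otimes> z = x \<otimes> (y \<otimes> (x \<otimes> z))"
  shows "moufang_loop G"
  using assms by (simp add: moufang_loop_def moufang_loop_axioms_def)

context moufang_loop
begin

lemma flexible:
  "\<lbrakk>x \<in> carrier G; y \<in> carrier G\<rbrakk> \<Longrightarrow> (x \<otimes> y) \<otimes> x = x \<otimes> (y \<otimes> x)"
  using moufang[of x y \<one>] by simp

text \<open>A right inverse \<open>x'\<close> is also a left one: flexibility gives x (x' x) = (x
  x') x = x, and \<open>x\<close> cancels.\<close>

lemma inverses_exist:
  assumes x: "x \<in> carrier G"
  obtains x' where "x' \<in> carrier G" "x \<otimes> x' = \<one>" "x' \<otimes> x = \<one>"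
proof -
  obtain x' where x': "x' \<in> carrier G" "x \<otimes> x' = \<one>"
    using left_quotient_exists[OF x one_in_carrier] by blast
  then have "x \<otimes> (x' \<otimes> x) = x \<otimes> \<one>"
    using flexible[OF x x'(1)] x by simp
  then have "x' \<otimes> x = \<one>"
    using x x' left_cancel[of x "x' \<otimes> x" \<one>] by simp
  with x' that show thesis by blast
qed

lemma inv_eqI:
  assumes "x \<in> carrier G" "y \<in> carrier G" "x \<otimes> y = \<one>"
  shows "inv x = y"
proof -
  obtain x' where x': "x' \<in> carrier G" "x \<otimes> x' = \<one>" "x' \<otimes> x = \<one>"
    using inverses_exist assms(1) by blast
  then have "x' = y"
    using assms left_cancel[of x x' y] by simp
  then show ?thesis
    unfolding m_inv_def
  proof (intro the_equality)
    show "z = y" if "z \<in> carrier G \<and> x \<otimes> z = \<one> \<and> z \<otimes> x = \<one>" for z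
      using that left_cancel[of x z y] assms by simp
  qed (use assms x' in simp)
qed

lemma inverse:
  assumes x: "x \<in> carrier G"
  shows inv_closed [simp]: "inv x \<in> carrier G"
    and right_inverse [simp]: "x \<otimes> inv x = \<one>"
    and left_inverse [simp]: "inv x \<otimes> x = \<one>"
proof -
  obtain x' where "x' \<in> carrier G" "x \<otimes> x' = \<one>" "x' \<otimes> x = \<one>"
    using inverses_exist x by blast
  with inv_eqI[OF x this(1,2)] show "inv x \<in> carrier G" "x \<otimes> inv x = \<one>" "inv x \<otimes> x = \<one>"
    by auto
qed

lemma inv_inv [simp]: "x \<in> carrier G \<Longrightarrow> inv (inv x) = x"
  by (intro inv_eqI) auto

lemma left_inverse_property [simp]:
  assumes "x \<in> carrier G" "z \<in> carrier G"
  shows "inv x \<otimes> (x \<otimes> z) = z" and "x \<otimes> (inv x \<otimes> z) = z"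
proof -
  \<comment> \<open>The Moufang law with middle element \<open>inv x\<close> reads x z = x (inv x (x
    z)); then \<open>x\<close> cancels.\<close>
  have *: "inv x \<otimes> (x \<otimes> z) = z" if "x \<in> carrier G" for x
    using moufang[of x "inv x" z] that assms(2) by simp
  then show "inv x \<otimes> (x \<otimes> z) = z" "x \<otimes> (inv x \<otimes> z) = z"
    using *[of "inv x"] assms by simp_all
qed

lemma right_inverse_property [simp]:
  assumes "x \<in> carrier G" "z \<in> carrier G"
  shows "(z \<otimes> x) \<otimes> inv x = z" and "(z \<otimes> inv x) \<otimes> x = z"
proof -
  \<comment> \<open>The instance reads ((x (inv x z)) x) inv x = x ((inv x z) (x inv x)). By the
    left inverse property its sides are (z x) inv x and z.\<close>
  have *: "(z \<otimes> x) \<otimes> inv x = z" if "x \<in> carrier G" for x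
    using moufang[of x "inv x \<otimes> z" "inv x"] that assms(2) by simp
  then show "(z \<otimes> x) \<otimes> inv x = z" "(z \<otimes> inv x) \<otimes> x = z"
    using *[of "inv x"] assms by simp_all
qed

lemma inv_mult:
  assumes "x \<in> carrier G" "y \<in> carrier G"
  shows "inv (x \<otimes> y) = inv y \<otimes> inv x"
proof -
  have "inv (x \<otimes> y) \<otimes> x = inv y"
    using left_inverse_property(1)[of "x \<otimes> y" "inv y"] assms by simp
  then have "inv y \<otimes> inv x = (inv (x \<otimes> y) \<otimes> x) \<otimes> inv x" by simp
  then show ?thesis using assms by simp
qed

section \<open>Central elements and their integer powers\<close>

lemma loop_center_closed [simp]: "c \<in> loop_center G \<Longrightarrow> c \<in> carrier G"
  by (simp add: loop_center_def)

lemma loop_center_comm: "\<lbrakk>c \<in> loop_center G; y \<in> carrier G\<rbrakk> \<Longrightarrow> c \<otimes> y = y \<otimes> c"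
  unfolding loop_center_iff by blast

lemma loop_center_assoc_left:
  "\<lbrakk>c \<in> loop_center G; y \<in> carrier G; z \<in> carrier G\<rbrakk> \<Longrightarrow> (c \<otimes> y) \<otimes> z = c \<otimes> (y \<otimes> z)"
  unfolding loop_center_iff by blast

text \<open>Inversion reverses products, so it turns the law for \<open>c\<close> in first position
  into a law for \<open>inv c\<close> in last position. Multiplying by \<open>c\<close> on the right
  then gives the law for \<open>c\<close> itself.\<close>

lemma loop_center_assoc_right:
  assumes c: "c \<in> loop_center G" and y: "y \<in> carrier G" and z: "z \<in> carrier G"
  shows "(y \<otimes> z) \<otimes> c = y \<otimes> (z \<otimes> c)"
proof -
  have cG: "c \<in> carrier G" using c by simp
  have inv_right: "(z \<otimes> y) \<otimes> inv c = z \<otimes> (y \<otimes> inv c)"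
    if "y \<in> carrier G" "z \<in> carrier G" for y z
  proof -
    have "inv ((c \<otimes> inv y) \<otimes> inv z) = inv (c \<otimes> (inv y \<otimes> inv z))"
      using loop_center_assoc_left[OF c, of "inv y" "inv z"] that by simp
    then show ?thesis using that cG by (simp add: inv_mult)
  qed
  have "(y \<otimes> (z \<otimes> c)) \<otimes> inv c = y \<otimes> z"
    using inv_right[of "z \<otimes> c" y] y z cG by simp
  then have "((y \<otimes> (z \<otimes> c)) \<otimes> inv c) \<otimes> c = (y \<otimes> z) \<otimes> c" by simp
  then show ?thesis using y z cG by simp
qed

lemma loop_center_assoc_mid:
  "\<lbrakk>c \<in> loop_center G; y \<in> carrier G; z \<in> carrier G\<rbrakk> \<Longrightarrow> (y \<otimes> c) \<otimes> z = y \<otimes> (c \<otimes> z)"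
  by (metis loop_center_assoc_left loop_center_assoc_right loop_center_comm mult_closed)

lemma mult_center_mult:
  assumes c: "c \<in> loop_center G" and d: "d \<in> loop_center G" and x: "x \<in> carrier G" and y: "y \<in> carrier G"
  shows "(x \<otimes> c) \<otimes> (y \<otimes> d) = (x \<otimes> y) \<otimes> (c \<otimes> d)"
proof -
  have "(x \<otimes> c) \<otimes> (y \<otimes> d) = ((x \<otimes> c) \<otimes> y) \<otimes> d"
    using c d x y by (simp add: loop_center_assoc_right)
  also have "(x \<otimes> c) \<otimes> y = (x \<otimes> y) \<otimes> c"
    using c x y by (simp add: loop_center_assoc_mid loop_center_assoc_right loop_center_comm[OF c y])
  finally show ?thesis
    using c d x y by (simp add: loop_center_assoc_right[OF d])
qed

lemma one_in_loop_center: "\<one> \<in> loop_center G"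
  unfolding loop_center_iff by (intro conjI ballI) simp_all

lemma mult_in_loop_center:
  assumes c: "c \<in> loop_center G" and d: "d \<in> loop_center G"
  shows "c \<otimes> d \<in> loop_center G"
  unfolding loop_center_iff
proof (intro conjI ballI)
  show "c \<otimes> d \<in> carrier G" using c d by simp
  show "(c \<otimes> d) \<otimes> y = y \<otimes> (c \<otimes> d)" if y: "y \<in> carrier G" for y
  proof -
    have "(c \<otimes> d) \<otimes> y = c \<otimes> (y \<otimes> d)"
      using c d y by (simp add: loop_center_assoc_left[OF c] loop_center_comm[OF d y])
    also have "\<dots> = (y \<otimes> c) \<otimes> d"
      using c d y by (simp flip: loop_center_assoc_left[OF c] loop_center_comm[OF c y])
    finally show ?thesis
      using c d y by (simp add: loop_center_assoc_right[OF d])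
  qed
  show "((c \<otimes> d) \<otimes> y) \<otimes> z = (c \<otimes> d) \<otimes> (y \<otimes> z)" if "y \<in> carrier G" "z \<in> carrier G" for y z
    using c d that by (simp add: loop_center_assoc_left[OF c] loop_center_assoc_left[OF d])
qed

lemma inv_in_loop_center:
  assumes c: "c \<in> loop_center G"
  shows "inv c \<in> loop_center G"
  unfolding loop_center_iff
proof (intro conjI ballI)
  show "inv c \<in> carrier G" using c by simp
  show "inv c \<otimes> y = y \<otimes> inv c" if y: "y \<in> carrier G" for y
  proof -
    have "c \<otimes> (y \<otimes> inv c) = (c \<otimes> y) \<otimes> inv c"
      using c y by (simp add: loop_center_assoc_left[OF c])
    also have "\<dots> = y"
      using c y by (simp add: loop_center_comm[OF c y])
    finally have "inv c \<otimes> (c \<otimes> (y \<otimes> inv c)) = inv c \<otimes> y" by simp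
    then show ?thesis
      using c y by simp
  qed
  show "(inv c \<otimes> y) \<otimes> z = inv c \<otimes> (y \<otimes> z)" if "y \<in> carrier G" "z \<in> carrier G" for y z
  proof -
    have "c \<otimes> ((inv c \<otimes> y) \<otimes> z) = y \<otimes> z"
      using c that by (simp flip: loop_center_assoc_left[OF c])
    then have "inv c \<otimes> (c \<otimes> ((inv c \<otimes> y) \<otimes> z)) = inv c \<otimes> (y \<otimes> z)" by simp
    then show ?thesis using c that by simp
  qed
qed

text \<open>Inside the center the product is associative, so the group laws of exponents hold there;
  \<open>int_pow_loop_center\<close> brings them back to \<open>G\<close>.\<close>

lemma comm_group_loop_center: "comm_group (G\<lparr>carrier := loop_center G\<rparr>)" (is "comm_group ?Z")
proof (rule comm_groupI)
  show "x \<otimes>\<^bsub>?Z\<^esub> y = y \<otimes>\<^bsub>?Z\<^esub> x" if "x \<in> carrier ?Z" "y \<in> carrier ?Z" for x y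
    using that loop_center_comm[of x y] by simp
  show "\<exists>y\<in>carrier ?Z. y \<otimes>\<^bsub>?Z\<^esub> x = \<one>\<^bsub>?Z\<^esub>" if "x \<in> carrier ?Z" for x
    using that by (intro bexI[of _ "inv x"]) (simp_all add: inv_in_loop_center)
qed (simp_all add: one_in_loop_center mult_in_loop_center loop_center_assoc_left)

text \<open>Restricting the carrier changes neither product nor unit, hence no natural power.
  Negative powers agree because an inverse in the center is a right inverse in \<open>G\<close>, and
  that one is unique.\<close>

lemma int_pow_loop_center:
  assumes c: "c \<in> loop_center G"
  shows "c [^]\<^bsub>G\<lparr>carrier := loop_center G\<rparr>\<^esub> (k::int) = c [^] k"
proof -
  interpret Z: comm_group "G\<lparr>carrier := loop_center G\<rparr>"
    by (rule comm_group_loop_center)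
  have nat_pow: "c [^]\<^bsub>G\<lparr>carrier := loop_center G\<rparr>\<^esub> (n::nat) = c [^] n" for n
    by (simp add: nat_pow_def)
  have "inv\<^bsub>G\<lparr>carrier := loop_center G\<rparr>\<^esub> x = inv x" if "x \<in> loop_center G" for x
    using that Z.inv_closed[of x] Z.r_inv[of x]
    by (intro inv_eqI[symmetric]) auto
  moreover have "c [^] (n::nat) \<in> loop_center G" for n
    using Z.nat_pow_closed[of c n] c by (simp add: nat_pow)
  ultimately show ?thesis
    unfolding int_pow_def2 nat_pow by (simp del: pow_nat)
qed

lemma center_int_pow:
  assumes c: "c \<in> loop_center G"
  shows center_int_pow_in_center: "c [^] (k::int) \<in> loop_center G"
    and center_int_pow_mult: "c [^] (k + l :: int) = c [^] k \<otimes> c [^] l"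
    and center_int_pow_1: "c [^] (1::int) = c"
    and center_nat_pow_inv: "(c [^] (n::nat)) \<otimes> c [^] (- int n) = \<one>"
proof -
  interpret Z: comm_group "G\<lparr>carrier := loop_center G\<rparr>"
    by (rule comm_group_loop_center)
  show "c [^] k \<in> loop_center G"
    using Z.int_pow_closed[of c k] c by (simp add: int_pow_loop_center)
  show *: "c [^] (k + l) = c [^] k \<otimes> c [^] l" for k l :: int
    using Z.int_pow_mult[of c k l] c by (simp add: int_pow_loop_center)
  show "c [^] (1::int) = c"
    using Z.int_pow_1[of c] c by (simp add: int_pow_loop_center)
  show "(c [^] (n::nat)) \<otimes> c [^] (- int n) = \<one>"
    using *[of "int n" "- int n"] by (simp add: int_pow_int)
qed

lemma subloop_generated_by_center:
  assumes c: "c \<in> loop_center G"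
  shows "subloop_generated_by G {c} = range (\<lambda>k::int. c [^] k)"
proof
  have closed: "c [^] (k::int) \<in> carrier G" for k
    using center_int_pow_in_center[OF c] by simp
  have "subloop (range (\<lambda>k::int. c [^] k)) G"
    unfolding subloop_def
  proof (intro conjI ballI impI)
    show "\<one> \<in> range (\<lambda>k::int. c [^] k)"
      by (metis int_pow_0 rangeI)
    fix x assume "x \<in> range (\<lambda>k::int. c [^] k)"
    then obtain k :: int where x: "x = c [^] k" by auto
    show "x \<otimes> y \<in> range (\<lambda>k::int. c [^] k)" if "y \<in> range (\<lambda>k::int. c [^] k)" for y
      using that x by (auto simp flip: center_int_pow_mult[OF c])
    fix z assume z: "z \<in> carrier G"
    show "z \<in> range (\<lambda>k::int. c [^] k)" if mem: "x \<otimes> z \<in> range (\<lambda>k::int. c [^] k)"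
    proof -
      obtain l :: int where l: "x \<otimes> z = c [^] l" using mem by auto
      then have "x \<otimes> z = x \<otimes> c [^] (l - k)"
        using center_int_pow_mult[OF c, of k "l - k"] x by simp
      then have "z = c [^] (l - k)"
        using z closed x left_cancel[of x z "c [^] (l - k)"] by blast
      then show ?thesis by blast
    qed
    show "z \<in> range (\<lambda>k::int. c [^] k)" if mem: "z \<otimes> x \<in> range (\<lambda>k::int. c [^] k)"
    proof -
      obtain l :: int where l: "z \<otimes> x = c [^] l" using mem by auto
      then have "z \<otimes> x = c [^] (l - k) \<otimes> x"
        using center_int_pow_mult[OF c, of "l - k" k] x by simp
      then have "z = c [^] (l - k)"
        using z closed x right_cancel[of x z "c [^] (l - k)"] by blast
      then show ?thesis by blast
    qed
  qed (use closed in auto)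
  then show "subloop_generated_by G {c} \<subseteq> range (\<lambda>k::int. c [^] k)"
    by (rule subloop_generated_by_least) (auto intro!: image_eqI[of _ _ 1] simp: center_int_pow_1[OF c])
  have "c [^] (k::int) \<in> H" if H: "subloop H G" "{c} \<subseteq> H" for H k
  proof -
    have nat: "c [^] (n::nat) \<in> H" for n
      using H subloop_one[OF H(1)] by (induction n) (auto intro: subloop_mult)
    show ?thesis
    proof (cases k rule: int_cases2)
      case (nonneg n)
      then show ?thesis using nat by (simp add: int_pow_int)
    next
      case (nonpos n)
      \<comment> \<open>The negative power is a left quotient of the unit by a natural power, so
        closure under division puts it into \<open>H\<close>.\<close>
      have "(c [^] n) \<otimes> c [^] (- int n) \<in> H"
        using subloop_one[OF H(1)] by (simp add: center_nat_pow_inv[OF c])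
      then show ?thesis
        using subloop_left_quotient[OF H(1) nat closed] nonpos by simp
    qed
  qed
  then show "range (\<lambda>k::int. c [^] k) \<subseteq> subloop_generated_by G {c}"
    unfolding subloop_generated_by_def by blast
qed

lemma normal_subloop_central:
  assumes H: "subloop H G" and Hc: "H \<subseteq> loop_center G"
  shows "normal_subloop H G"
proof -
  have c: "c \<in> loop_center G" if "c \<in> H" for c using that Hc by blast
  show ?thesis
    unfolding normal_subloop_def
  proof (intro conjI ballI H)
    fix x y assume x: "x \<in> carrier G" and y: "y \<in> carrier G"
    show "x <# H = H #> x"
      unfolding l_coset_def r_coset_def
      by (intro SUP_cong refl) (simp add: loop_center_comm[OF c x])
    show "x <# (y <# H) = (x \<otimes> y) <# H"
      using x y by (auto simp: l_coset_def loop_center_assoc_right c)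
    show "(H #> x) #> y = H #> (x \<otimes> y)"
      using x y by (auto simp: r_coset_def loop_center_assoc_left c)
  qed
qed

end

section \<open>Quotient loops\<close>

context loop
begin

context
  fixes H
  assumes normal: "normal_subloop H G"
begin

lemma normal_subloop_subloop: "subloop H G"
  using normal by (simp add: normal_subloop_def)

lemma normal_subloop_subset: "x \<in> H \<Longrightarrow> x \<in> carrier G"
  using subloop_subset[OF normal_subloop_subloop] by blast

lemma l_coset_eq_r_coset: "x \<in> carrier G \<Longrightarrow> x <# H = H #> x"
  using normal by (simp add: normal_subloop_def)

lemma mem_own_coset: "x \<in> carrier G \<Longrightarrow> x \<in> H #> x"
  using subloop_one[OF normal_subloop_subloop] by (force simp: r_coset_def)

lemma coset_of_member: "x \<in> H \<Longrightarrow> x <# H = H"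
proof (intro subset_antisym subsetI)
  fix y assume x: "x \<in> H"
  show "y \<in> H" if "y \<in> x <# H"
    using that x by (auto simp: l_coset_def intro: subloop_mult[OF normal_subloop_subloop])
  assume y: "y \<in> H"
  obtain z where z: "z \<in> carrier G" "x \<otimes> z = y"
    using left_quotient_exists[of x y] normal_subloop_subset x y by auto
  then have "z \<in> H"
    using x y by (intro subloop_left_quotient[OF normal_subloop_subloop, of x z]) simp_all
  with z show "y \<in> x <# H" by (auto simp: l_coset_def)
qed

lemma l_coset_mult: "\<lbrakk>x \<in> carrier G; y \<in> carrier G\<rbrakk> \<Longrightarrow> x <# (H #> y) = H #> (x \<otimes> y)"
  using normal l_coset_eq_r_coset mult_closed unfolding normal_subloop_def by metis

lemma r_coset_mult: "\<lbrakk>x \<in> carrier G; y \<in> carrier G\<rbrakk> \<Longrightarrow> (H #> x) #> y = H #> (x \<otimes> y)"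
  using normal unfolding normal_subloop_def by blast

text \<open>Writing y = x h with h in \<open>H\<close>, normality gives (x h) H = x (h H), and h H =
  H.\<close>

lemma coset_eqI:
  assumes x: "x \<in> carrier G" and y: "y \<in> H #> x"
  shows "H #> y = H #> x"
proof -
  obtain h where h: "h \<in> H" "y = x \<otimes> h"
    using x y by (auto simp: l_coset_def simp flip: l_coset_eq_r_coset)
  then have hG: "h \<in> carrier G"
    using normal_subloop_subset by auto
  have "H #> y = x <# (h <# H)"
    using h hG x by (simp add: l_coset_eq_r_coset l_coset_mult)
  then show ?thesis
    using h x by (simp add: coset_of_member l_coset_eq_r_coset)
qed

lemma coset_subset: "x \<in> carrier G \<Longrightarrow> H #> x \<subseteq> carrier G"
  using normal_subloop_subset by (auto simp: r_coset_def)

text \<open>Each \<open>u\<close> in the first coset contributes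
  \<open>H #> (u \<otimes> y)\<close>, and \<open>u \<otimes> y\<close> runs through
  \<open>H #> (x \<otimes> y)\<close>, so every contribution is this one coset. The two
  associativity clauses of normality stand in for associativity of \<open>G\<close>.\<close>

lemma set_mult_cosets:
  assumes x: "x \<in> carrier G" and y: "y \<in> carrier G"
  shows "(H #> x) <#> (H #> y) = H #> (x \<otimes> y)"
proof -
  have "(H #> x) <#> (H #> y) = (\<Union>u\<in>H #> x. u <# (H #> y))"
    by (simp add: set_mult_def l_coset_def)
  also have "\<dots> = (\<Union>u\<in>H #> x. H #> (u \<otimes> y))"
    using coset_subset[OF x] y by (auto simp: l_coset_mult subset_eq)
  also have "\<dots> = (\<Union>v\<in>(H #> x) #> y. H #> v)"
    by (auto simp: r_coset_def)
  also have "\<dots> = (\<Union>v\<in>H #> (x \<otimes> y). H #> v)"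
    using x y by (simp add: r_coset_mult)
  also have "\<dots> = (\<Union>v\<in>H #> (x \<otimes> y). H #> (x \<otimes> y))"
    using coset_eqI[of "x \<otimes> y"] x y by auto
  also have "\<dots> = H #> (x \<otimes> y)"
    using mem_own_coset[of "x \<otimes> y"] x y by auto
  finally show ?thesis .
qed

lemma coset_one [simp]: "H #> \<one> = H"
  using normal_subloop_subset by (force simp: r_coset_def)

lemma coset_eq_iff:
  "\<lbrakk>x \<in> carrier G; y \<in> carrier G\<rbrakk> \<Longrightarrow> H #> x = H #> y \<longleftrightarrow> x \<in> H #> y"
  using coset_eqI mem_own_coset by blast

text \<open>Normality turns H (a y) into a (H y), so a x = a z for some z in H y, and cancellation
  in \<open>G\<close> gives x = z.\<close>

lemma coset_left_cancel:
  assumes "a \<in> carrier G" "x \<in> carrier G" "y \<in> carrier G" "H #> (a \<otimes> x) = H #> (a \<otimes> y)"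
  shows "H #> x = H #> y"
proof -
  have "a \<otimes> x \<in> a <# (H #> y)"
    using assms by (simp add: l_coset_mult coset_eq_iff)
  then obtain z where "z \<in> H #> y" "a \<otimes> x = a \<otimes> z"
    by (auto simp: l_coset_def)
  moreover from this have "z \<in> carrier G"
    using coset_subset assms by auto
  ultimately show ?thesis
    using assms by (simp add: coset_eq_iff)
qed

lemma coset_right_cancel:
  assumes "a \<in> carrier G" "x \<in> carrier G" "y \<in> carrier G" "H #> (x \<otimes> a) = H #> (y \<otimes> a)"
  shows "H #> x = H #> y"
proof -
  have "x \<otimes> a \<in> (H #> y) #> a"
    using assms by (simp add: r_coset_mult coset_eq_iff)
  then obtain z where "z \<in> H #> y" "x \<otimes> a = z \<otimes> a"
    by (auto simp: r_coset_def)
  moreover from this have "z \<in> carrier G"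
    using coset_subset assms by auto
  ultimately show ?thesis
    using assms by (simp add: coset_eq_iff)
qed

lemma loop_Mod: "loop (G Mod H)"
proof
  let ?Q = "G Mod H"
  note [simp] = carrier_FactGroup set_mult_cosets
  show "X \<otimes>\<^bsub>?Q\<^esub> Y \<in> carrier ?Q" if "X \<in> carrier ?Q" "Y \<in> carrier ?Q" for X Y
    using that by auto
  show "\<one>\<^bsub>?Q\<^esub> \<in> carrier ?Q"
    by (auto intro!: image_eqI[of _ _ \<one>])
  show "\<one>\<^bsub>?Q\<^esub> \<otimes>\<^bsub>?Q\<^esub> X = X" if "X \<in> carrier ?Q" for X
    using that set_mult_cosets[OF one_in_carrier] by auto
  show "X \<otimes>\<^bsub>?Q\<^esub> \<one>\<^bsub>?Q\<^esub> = X" if "X \<in> carrier ?Q" for X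
    using that set_mult_cosets[OF _ one_in_carrier] by auto
  fix X Y assume "X \<in> carrier ?Q" "Y \<in> carrier ?Q"
  then obtain a b where a: "a \<in> carrier G" "X = H #> a" and b: "b \<in> carrier G" "Y = H #> b"
    by auto
  obtain x where x: "x \<in> carrier G" "a \<otimes> x = b"
    using left_quotient_exists a(1) b(1) by blast
  show "\<exists>!Z. Z \<in> carrier ?Q \<and> X \<otimes>\<^bsub>?Q\<^esub> Z = Y"
  proof (rule ex1I)
    show "H #> x \<in> carrier ?Q \<and> X \<otimes>\<^bsub>?Q\<^esub> (H #> x) = Y"
      using a b x by auto
    show "Z = H #> x" if Z: "Z \<in> carrier ?Q \<and> X \<otimes>\<^bsub>?Q\<^esub> Z = Y" for Z
    proof -
      obtain z where z: "z \<in> carrier G" "Z = H #> z"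
        using Z by auto
      then have "H #> (a \<otimes> z) = H #> (a \<otimes> x)"
        using Z a b x by simp
      then show ?thesis
        using coset_left_cancel[of a z x] z a x by blast
    qed
  qed
  obtain x where x: "x \<in> carrier G" "x \<otimes> a = b"
    using right_quotient_exists a(1) b(1) by blast
  show "\<exists>!Z. Z \<in> carrier ?Q \<and> Z \<otimes>\<^bsub>?Q\<^esub> X = Y"
  proof (rule ex1I)
    show "H #> x \<in> carrier ?Q \<and> (H #> x) \<otimes>\<^bsub>?Q\<^esub> X = Y"
      using a b x by auto
    show "Z = H #> x" if Z: "Z \<in> carrier ?Q \<and> Z \<otimes>\<^bsub>?Q\<^esub> X = Y" for Z
    proof -
      obtain z where z: "z \<in> carrier G" "Z = H #> z"
        using Z by auto
      then have "H #> (z \<otimes> a) = H #> (x \<otimes> a)"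
        using Z a b x by simp
      then show ?thesis
        using coset_right_cancel[of a z x] z a x by blast
    qed
  qed
qed

end

end

lemma (in moufang_loop) moufang_loop_Mod:
  assumes "normal_subloop H G"
  shows "moufang_loop (G Mod H)"
  using assms
  by (intro moufang_loopI loop_Mod)
    (auto simp: carrier_FactGroup set_mult_cosets moufang)

section \<open>Central extensions and factor sets\<close>

context moufang_loop
begin

lemma mult_central_right:
  assumes "c \<in> loop_center G" "x \<in> carrier G" "y \<in> carrier G"
  shows "(x \<otimes> c) \<otimes> y = (x \<otimes> y) \<otimes> c" and "x \<otimes> (y \<otimes> c) = (x \<otimes> y) \<otimes> c"
  using mult_center_mult[OF assms(1) one_in_loop_center assms(2,3)]
    mult_center_mult[OF one_in_loop_center assms]
  using assms by simp_all

text \<open>Moving the corrections out of a bracketed word collects the last one first, whereas the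
  factor set conditions list them in the opposite order.\<close>

lemma loop_center_mult_rev:
  assumes a: "a \<in> loop_center G" and b: "b \<in> loop_center G" and c: "c \<in> loop_center G"
  shows "(c \<otimes> b) \<otimes> a = (a \<otimes> b) \<otimes> c"
proof -
  have "(c \<otimes> b) \<otimes> a = a \<otimes> (c \<otimes> b)"
    using b c by (simp add: loop_center_comm[OF a, of "c \<otimes> b"])
  also have "\<dots> = a \<otimes> (b \<otimes> c)"
    using b by (simp add: loop_center_comm[OF c, of b])
  also have "\<dots> = (a \<otimes> b) \<otimes> c"
    using b c by (simp add: loop_center_assoc_left[OF a])
  finally show ?thesis .
qed

lemma comm_group_central_subloop:
  assumes A: "subloop A G" and Ac: "A \<subseteq> loop_center G"
  shows "comm_group (G\<lparr>carrier := A\<rparr>)" (is "comm_group ?A")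
proof (rule comm_groupI)
  have c: "a \<in> loop_center G" if "a \<in> A" for a using that Ac by blast
  show "x \<otimes>\<^bsub>?A\<^esub> y = y \<otimes>\<^bsub>?A\<^esub> x" if "x \<in> carrier ?A" "y \<in> carrier ?A" for x y
    using that loop_center_comm[of x y] c by simp
  show "\<exists>y\<in>carrier ?A. y \<otimes>\<^bsub>?A\<^esub> x = \<one>\<^bsub>?A\<^esub>" if x: "x \<in> carrier ?A" for x
  proof -
    have "inv x \<in> A"
      using x c[of x] subloop_one[OF A] by (auto intro: subloop_left_quotient[OF A, of x "inv x"])
    then show ?thesis
      using x c[of x] by (intro bexI[of _ "inv x"]) simp_all
  qed
  show "(x \<otimes>\<^bsub>?A\<^esub> y) \<otimes>\<^bsub>?A\<^esub> z = x \<otimes>\<^bsub>?A\<^esub> (y \<otimes>\<^bsub>?A\<^esub> z)"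
    if "x \<in> carrier ?A" "y \<in> carrier ?A" "z \<in> carrier ?A" for x y z
    using that c by (simp add: loop_center_assoc_left)
  show "\<one>\<^bsub>?A\<^esub> \<otimes>\<^bsub>?A\<^esub> x = x" if "x \<in> carrier ?A" for x
    using that c by simp
qed (simp_all add: subloop_one[OF A] subloop_mult[OF A])

end

lemma trivial_action_apply [simp]: "a \<in> carrier A \<Longrightarrow> trivial_action A x a = a"
  by (simp add: trivial_action_def AutoGroup_def BijGroup_def)

lemma trivial_factor_setI:
  assumes Q: "moufang_loop Q" and A: "comm_group A"
    and closed: "\<And>x y. \<lbrakk>x \<in> carrier Q; y \<in> carrier Q\<rbrakk> \<Longrightarrow> \<eta> x y \<in> carrier A"
    and one: "\<And>x. x \<in> carrier Q \<Longrightarrow> \<eta> x \<one>\<^bsub>Q\<^esub> = \<one>\<^bsub>A\<^esub>"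
      "\<And>x. x \<in> carrier Q \<Longrightarrow> \<eta> \<one>\<^bsub>Q\<^esub> x = \<one>\<^bsub>A\<^esub>"
  shows "factor_set Q A (trivial_action A) \<eta>"
proof -
  interpret comm_group A by (rule A)
  interpret Aut: group "AutoGroup A" by (rule AutoGroup)
  show ?thesis
    by (rule factor_set.intro) (simp_all add: Q A closed one trivial_action_def)
qed

lemma trivial_moufang_factor_set_iff:
  "moufang_factor_set Q A (trivial_action A) \<eta> \<longleftrightarrow>
    factor_set Q A (trivial_action A) \<eta> \<and>
    (\<forall>x\<in>carrier Q. \<forall>y\<in>carrier Q. \<forall>z\<in>carrier Q.
      \<eta> x y \<otimes>\<^bsub>A\<^esub> \<eta> (x \<otimes>\<^bsub>Q\<^esub> y) x \<otimes>\<^bsub>A\<^esub> \<eta> ((x \<otimes>\<^bsub>Q\<^esub> y) \<otimes>\<^bsub>Q\<^esub> x) z =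
      \<eta> x z \<otimes>\<^bsub>A\<^esub> \<eta> y (x \<otimes>\<^bsub>Q\<^esub> z) \<otimes>\<^bsub>A\<^esub> \<eta> x (y \<otimes>\<^bsub>Q\<^esub> (x \<otimes>\<^bsub>Q\<^esub> z)))"
proof (cases "factor_set Q A (trivial_action A) \<eta>")
  case True
  then interpret factor_set Q A "trivial_action A" \<eta> .
  interpret Q: moufang_loop Q by (rule moufang_loop_Q)
  show ?thesis
    using True unfolding moufang_factor_set_def moufang_factor_set_axioms_def
    by (auto simp: cocycle_closed)
next
  case False
  then show ?thesis
    by (auto simp: moufang_factor_set_def)
qed

lemma trivial_associative_factor_setI:
  assumes "factor_set Q A (trivial_action A) \<eta>"
    and assoc: "\<And>x y z. \<lbrakk>x \<in> carrier Q; y \<in> carrier Q; z \<in> carrier Q\<rbrakk> \<Longrightarrow>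
      \<eta> x y \<otimes>\<^bsub>A\<^esub> \<eta> (x \<otimes>\<^bsub>Q\<^esub> y) z = \<eta> y z \<otimes>\<^bsub>A\<^esub> \<eta> x (y \<otimes>\<^bsub>Q\<^esub> z)"
  shows "associative_factor_set Q A (trivial_action A) \<eta>"
proof -
  interpret factor_set Q A "trivial_action A" \<eta> by (rule assms)
  show ?thesis
    by unfold_locales (simp add: assoc cocycle_closed)
qed

text \<open>The condition is additive in the cocycle because the action is trivial and
  \<open>A\<close> commutative. The separate \<open>\<nu>\<close> is there because
  \<open>\<eta>star\<close> is known only on the carrier of the quotient.\<close>

lemma moufang_factor_set_sum:
  assumes \<eta>: "moufang_factor_set Q A (trivial_action A) \<eta>"
    and \<mu>: "moufang_factor_set Q A (trivial_action A) \<mu>"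
    and \<nu>: "\<And>x y. \<lbrakk>x \<in> carrier Q; y \<in> carrier Q\<rbrakk> \<Longrightarrow> \<nu> x y = cocycle_sum A \<eta> \<mu> x y"
  shows "moufang_factor_set Q A (trivial_action A) \<nu>"
proof -
  interpret \<eta>: moufang_factor_set Q A "trivial_action A" \<eta> by (rule \<eta>)
  interpret \<mu>: moufang_factor_set Q A "trivial_action A" \<mu> by (rule \<mu>)
  interpret A: comm_group A by (rule \<eta>.comm_group_A)
  interpret Q: moufang_loop Q by (rule \<eta>.moufang_loop_Q)
  note \<nu>' = \<nu>[unfolded cocycle_sum_def]
  note closed = \<eta>.cocycle_closed \<mu>.cocycle_closed
  have fs: "factor_set Q A (trivial_action A) \<nu>"
    by (rule trivial_factor_setI)
      (simp_all add: \<nu>' closed \<eta>.moufang_loop_Q \<eta>.comm_group_A \<eta>.cocycle_one_right \<mu>.cocycle_one_right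
        \<eta>.cocycle_one_left \<mu>.cocycle_one_left)
  have rearrange: "(a \<otimes>\<^bsub>A\<^esub> a') \<otimes>\<^bsub>A\<^esub> (b \<otimes>\<^bsub>A\<^esub> b') \<otimes>\<^bsub>A\<^esub> (c \<otimes>\<^bsub>A\<^esub> c') =
      (a \<otimes>\<^bsub>A\<^esub> b \<otimes>\<^bsub>A\<^esub> c) \<otimes>\<^bsub>A\<^esub> (a' \<otimes>\<^bsub>A\<^esub> b' \<otimes>\<^bsub>A\<^esub> c')"
    if "a \<in> carrier A" "b \<in> carrier A" "c \<in> carrier A" "a' \<in> carrier A" "b' \<in> carrier A" "c' \<in> carrier A"
    for a b c a' b' c'
    using that by (simp add: A.m_ac)
  show ?thesis
    using \<eta> \<mu> fs unfolding trivial_moufang_factor_set_iff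
    by (simp add: \<nu>' rearrange closed)
qed

text \<open>A product of values of a transversal is the value at the product in the quotient times a
  central correction; comparing the corrections on both sides of the Moufang identity gives the
  cocycle identity.\<close>

lemma (in moufang_loop) transversal_moufang_factor_set:
  assumes A: "subloop A G" and Ac: "A \<subseteq> loop_center G"
    and closed: "\<And>X. X \<in> carrier (G Mod A) \<Longrightarrow> \<pi> X \<in> carrier G"
    and one: "\<pi> A = \<one>"
    and \<eta>_closed: "\<And>X Y. \<lbrakk>X \<in> carrier (G Mod A); Y \<in> carrier (G Mod A)\<rbrakk> \<Longrightarrow> \<eta> X Y \<in> A"
    and \<eta>: "\<And>X Y. \<lbrakk>X \<in> carrier (G Mod A); Y \<in> carrier (G Mod A)\<rbrakk>
      \<Longrightarrow> \<pi> X \<otimes> \<pi> Y = \<pi> (X \<otimes>\<^bsub>G Mod A\<^esub> Y) \<otimes> \<eta> X Y"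
  shows "moufang_factor_set (G Mod A) (G\<lparr>carrier := A\<rparr>) (trivial_action (G\<lparr>carrier := A\<rparr>)) \<eta>"
proof -
  let ?Q = "G Mod A" and ?A = "G\<lparr>carrier := A\<rparr>"
  interpret Q: moufang_loop ?Q
    by (intro moufang_loop_Mod normal_subloop_central A Ac)
  have c: "\<eta> X Y \<in> loop_center G" if "X \<in> carrier ?Q" "Y \<in> carrier ?Q" for X Y
    using \<eta>_closed[OF that] Ac by blast
  \<comment> \<open>Where the transversal multiplies exactly, no correction is left. With
    \<open>\<pi> A = \<one>\<close> this covers products with the unit coset and gives the
    normalization.\<close>
  have \<eta>_one: "\<eta> X Y = \<one>"
    if X: "X \<in> carrier ?Q" and Y: "Y \<in> carrier ?Q" and eq: "\<pi> X \<otimes> \<pi> Y = \<pi> (X \<otimes>\<^bsub>?Q\<^esub> Y)" for X Y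
  proof -
    have "\<pi> (X \<otimes>\<^bsub>?Q\<^esub> Y) \<otimes> \<eta> X Y = \<pi> (X \<otimes>\<^bsub>?Q\<^esub> Y) \<otimes> \<one>"
      using \<eta>[OF X Y] eq closed[OF Q.mult_closed[OF X Y]] by simp
    then show ?thesis
      using left_cancel[OF closed[OF Q.mult_closed[OF X Y]], of "\<eta> X Y" \<one>] c[OF X Y] by simp
  qed
  have fs: "factor_set ?Q ?A (trivial_action ?A) \<eta>"
  proof (rule trivial_factor_setI)
    show "\<eta> X \<one>\<^bsub>?Q\<^esub> = \<one>\<^bsub>?A\<^esub>" if "X \<in> carrier ?Q" for X
      using \<eta>_one[of X "\<one>\<^bsub>?Q\<^esub>"] that Q.mult_one[OF that] Q.one_in_carrier closed[OF that] one by simp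
    show "\<eta> \<one>\<^bsub>?Q\<^esub> X = \<one>\<^bsub>?A\<^esub>" if "X \<in> carrier ?Q" for X
      using \<eta>_one[of "\<one>\<^bsub>?Q\<^esub>" X] that Q.one_mult[OF that] Q.one_in_carrier closed[OF that] one by simp
  qed (use comm_group_central_subloop[OF A Ac] \<eta>_closed Q.moufang_loop_axioms in simp_all)
  have "\<eta> X Y \<otimes> \<eta> (X \<otimes>\<^bsub>?Q\<^esub> Y) X \<otimes> \<eta> ((X \<otimes>\<^bsub>?Q\<^esub> Y) \<otimes>\<^bsub>?Q\<^esub> X) Z =
      \<eta> X Z \<otimes> \<eta> Y (X \<otimes>\<^bsub>?Q\<^esub> Z) \<otimes> \<eta> X (Y \<otimes>\<^bsub>?Q\<^esub> (X \<otimes>\<^bsub>?Q\<^esub> Z))"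
    if X: "X \<in> carrier ?Q" and Y: "Y \<in> carrier ?Q" and Z: "Z \<in> carrier ?Q" for X Y Z
  proof -
    define XY XYX XYXZ where "XY = X \<otimes>\<^bsub>?Q\<^esub> Y" and "XYX = XY \<otimes>\<^bsub>?Q\<^esub> X" and "XYXZ = XYX \<otimes>\<^bsub>?Q\<^esub> Z"
    define XZ YXZ where "XZ = X \<otimes>\<^bsub>?Q\<^esub> Z" and "YXZ = Y \<otimes>\<^bsub>?Q\<^esub> XZ"
    have Q: "XY \<in> carrier ?Q" "XYX \<in> carrier ?Q" "XYXZ \<in> carrier ?Q" "XZ \<in> carrier ?Q" "YXZ \<in> carrier ?Q"
      using X Y Z Q.mult_closed by (simp_all only: XY_def XYX_def XYXZ_def XZ_def YXZ_def)
    \<comment> \<open>The quotient is Moufang as well, so both bracketings end at the same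
      transversal value, which can be cancelled at the end.\<close>
    have XYXZ: "XYXZ = X \<otimes>\<^bsub>?Q\<^esub> YXZ"
      unfolding XY_def XYX_def XYXZ_def XZ_def YXZ_def by (rule Q.moufang[OF X Y Z])
    have \<pi>: "\<pi> X \<in> carrier G" "\<pi> Y \<in> carrier G" "\<pi> Z \<in> carrier G" "\<pi> XY \<in> carrier G"
      "\<pi> XYX \<in> carrier G" "\<pi> XYXZ \<in> carrier G" "\<pi> XZ \<in> carrier G" "\<pi> YXZ \<in> carrier G"
      using closed X Y Z Q by simp_all
    define a1 a2 a3 where a: "a1 = \<eta> X Y" "a2 = \<eta> XY X" "a3 = \<eta> XYX Z"
    define b1 b2 b3 where b: "b1 = \<eta> X Z" "b2 = \<eta> Y XZ" "b3 = \<eta> X YXZ"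
    have ac: "a1 \<in> loop_center G" "a2 \<in> loop_center G" "a3 \<in> loop_center G"
      and bc: "b1 \<in> loop_center G" "b2 \<in> loop_center G" "b3 \<in> loop_center G"
      unfolding a b using c X Y Z Q by blast+
    have p: "\<pi> X \<otimes> \<pi> Y = \<pi> XY \<otimes> a1" "\<pi> XY \<otimes> \<pi> X = \<pi> XYX \<otimes> a2" "\<pi> XYX \<otimes> \<pi> Z = \<pi> XYXZ \<otimes> a3"
      "\<pi> X \<otimes> \<pi> Z = \<pi> XZ \<otimes> b1" "\<pi> Y \<otimes> \<pi> XZ = \<pi> YXZ \<otimes> b2" "\<pi> X \<otimes> \<pi> YXZ = \<pi> XYXZ \<otimes> b3"
      unfolding a b
      using \<eta>[OF X Y, folded XY_def] \<eta>[OF Q(1) X, folded XYX_def] \<eta>[OF Q(2) Z, folded XYXZ_def]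
        \<eta>[OF X Z, folded XZ_def] \<eta>[OF Y Q(4), folded YXZ_def] \<eta>[OF X Q(5), folded XYXZ]
      by this
    have "((\<pi> X \<otimes> \<pi> Y) \<otimes> \<pi> X) \<otimes> \<pi> Z = ((\<pi> XYXZ \<otimes> a3) \<otimes> a2) \<otimes> a1"
      using \<pi> ac
      by (simp add: p(1-3) mult_central_right(1)[OF ac(1) \<pi>(4,1)]
          mult_central_right(1)[OF ac(1), of "\<pi> XYX \<otimes> a2" "\<pi> Z"]
          mult_central_right(1)[OF ac(2) \<pi>(5,3)])
    also have "\<dots> = \<pi> XYXZ \<otimes> (a3 \<otimes> a2 \<otimes> a1)"
      using \<pi> ac by (simp add: loop_center_assoc_right)
    also have "a3 \<otimes> a2 \<otimes> a1 = a1 \<otimes> a2 \<otimes> a3"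
      by (rule loop_center_mult_rev[OF ac])
    finally have L: "((\<pi> X \<otimes> \<pi> Y) \<otimes> \<pi> X) \<otimes> \<pi> Z = \<pi> XYXZ \<otimes> (a1 \<otimes> a2 \<otimes> a3)" .
    have "\<pi> X \<otimes> (\<pi> Y \<otimes> (\<pi> X \<otimes> \<pi> Z)) = ((\<pi> XYXZ \<otimes> b3) \<otimes> b2) \<otimes> b1"
      using \<pi> bc
      by (simp add: p(4-6) mult_central_right(2)[OF bc(1) \<pi>(2,7)]
          mult_central_right(2)[OF bc(1), of "\<pi> X" "\<pi> YXZ \<otimes> b2"]
          mult_central_right(2)[OF bc(2) \<pi>(1,8)])
    also have "\<dots> = \<pi> XYXZ \<otimes> (b3 \<otimes> b2 \<otimes> b1)"
      using \<pi> bc by (simp add: loop_center_assoc_right)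
    also have "b3 \<otimes> b2 \<otimes> b1 = b1 \<otimes> b2 \<otimes> b3"
      by (rule loop_center_mult_rev[OF bc])
    finally have R: "\<pi> X \<otimes> (\<pi> Y \<otimes> (\<pi> X \<otimes> \<pi> Z)) = \<pi> XYXZ \<otimes> (b1 \<otimes> b2 \<otimes> b3)" .
    have "\<pi> XYXZ \<otimes> (a1 \<otimes> a2 \<otimes> a3) = \<pi> XYXZ \<otimes> (b1 \<otimes> b2 \<otimes> b3)"
      using moufang[OF \<pi>(1-3)] unfolding L R .
    then have "a1 \<otimes> a2 \<otimes> a3 = b1 \<otimes> b2 \<otimes> b3"
      using \<pi> ac bc left_cancel[of "\<pi> XYXZ" "a1 \<otimes> a2 \<otimes> a3" "b1 \<otimes> b2 \<otimes> b3"] by simp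
    then show ?thesis
      unfolding a b XY_def XYX_def XYXZ_def XZ_def YXZ_def .
  qed
  then show ?thesis
    unfolding trivial_moufang_factor_set_iff using fs by simp
qed

section \<open>The cyclic construction\<close>

text \<open>\<open>exponents m\<close> consists of 2m consecutive integers, so two of its members
  differ by less than 2m.\<close>

lemma exponents_eqI:
  assumes "i \<in> exponents m" "j \<in> exponents m" "2 * int m dvd i - j"
  shows "i = j"
proof -
  have "\<bar>i - j\<bar> < 2 * int m"
    using assms(1,2) by (auto simp: exponents_def)
  with assms(3) dvd_imp_le_int[of "i - j" "2 * int m"] show ?thesis
    by fastforce
qed

lemma sigma_exponents [simp]: "i \<in> exponents m \<Longrightarrow> sigma m i = 0"
  by (auto simp: exponents_def sigma_def)

text \<open>The carry of addition modulo \<open>2 * m\<close> on the representatives \<^const>\<open>exponents\<close>.\<close>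

lemma add_exponents_eq:
  assumes i: "i \<in> exponents m" and j: "j \<in> exponents m" and k: "k \<in> exponents m"
    and cong: "2 * int m dvd i + j - k"
  shows "i + j = k + 2 * int m * sigma m (i + j)"
proof -
  \<comment> \<open>The sum lies between 2 - 2m and 2m. At most one shift by 2m, in the direction
    given by \<open>sigma\<close>, brings it back into \<open>exponents m\<close>, where its residue
    class has a single member.\<close>
  have "i + j - 2 * int m * sigma m (i + j) = k"
  proof (rule exponents_eqI)
    show "i + j - 2 * int m * sigma m (i + j) \<in> exponents m"
      using i j by (auto simp: exponents_def sigma_def)
    show "2 * int m dvd i + j - 2 * int m * sigma m (i + j) - k"
      using dvd_diff[OF cong, of "2 * int m * sigma m (i + j)"] by (simp add: algebra_simps)
  qed (rule k)
  then show ?thesis by simp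
qed

section \<open>Exponents of the cosets of \<open>S\<close>, and the carry\<close>

locale cyclic_setting = moufang_loop +
  fixes S :: "'a set" and m :: nat and \<alpha> :: "'a set" and h :: 'a
  assumes condition_C: "condition_C G S m \<alpha> h"
begin

abbreviation e :: "'a \<Rightarrow> int"
  where "e \<equiv> coset_exponent G S m \<alpha>"

abbreviation carry :: "'a \<Rightarrow> 'a \<Rightarrow> int"
  where "carry x y \<equiv> sigma m (e x + e y)"

abbreviation Gs :: "('a, 'b) monoid_scheme"
  where "Gs \<equiv> cyclic_construction G S m \<alpha> h"

lemma m_pos: "m > 0" and S_normal: "normal_subloop S G" and K_group: "group (G Mod S)"
  and \<alpha>: "\<alpha> \<in> carrier (G Mod S)"
  and K_generated: "carrier (G Mod S) = generate (G Mod S) {\<alpha>}"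
  and K_order: "order (G Mod S) = 2 * m"
  and h_in_S: "h \<in> S" and h_central [simp]: "h \<in> loop_center G"
  using condition_C by (auto simp: condition_C_def)

sublocale K: group "G Mod S"
  by (rule K_group)

lemmas S_subloop = normal_subloop_subloop[OF S_normal]
lemmas S_closed [simp] = normal_subloop_subset[OF S_normal]

text \<open>As \<open>\<alpha>\<close> generates a group of order 2m, its own order is 2m.\<close>

lemma \<alpha>_pow_eq_iff: "\<alpha> [^]\<^bsub>G Mod S\<^esub> (i::int) = \<alpha> [^]\<^bsub>G Mod S\<^esub> (j::int) \<longleftrightarrow> 2 * int m dvd j - i"
proof -
  have "K.ord \<alpha> = 2 * m"
    using K.generate_pow_card[OF \<alpha>] K_generated K_order by (simp add: order_def)
  then show ?thesis
    using K.int_pow_eq[OF \<alpha>, of i j] by simp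
qed

lemma coset_in_K: "x \<in> carrier G \<Longrightarrow> S #> x \<in> carrier (G Mod S)"
  by (auto simp: carrier_FactGroup)

lemma coset_eq_\<alpha>_pow:
  assumes x: "x \<in> carrier G" and mem: "x \<in> \<alpha> [^]\<^bsub>G Mod S\<^esub> (i::int)"
  shows "\<alpha> [^]\<^bsub>G Mod S\<^esub> i = S #> x"
proof -
  obtain y where y: "y \<in> carrier G" "\<alpha> [^]\<^bsub>G Mod S\<^esub> i = S #> y"
    using K.int_pow_closed[OF \<alpha>, of i] by (auto simp: carrier_FactGroup)
  then show ?thesis
    using coset_eqI[OF S_normal y(1)] mem by simp
qed

lemma exponent_exists:
  assumes x: "x \<in> carrier G"
  shows "\<exists>i\<in>exponents m. x \<in> \<alpha> [^]\<^bsub>G Mod S\<^esub> i"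
proof -
  obtain k :: int where k: "S #> x = \<alpha> [^]\<^bsub>G Mod S\<^esub> k"
    using coset_in_K[OF x] K_generated K.generate_pow[OF \<alpha>] by auto
  \<comment> \<open>Adding m - 1 moves the window \<open>exponents m\<close> to the standard
    residues 0, ..., 2m - 1; after reduction the shift is undone.\<close>
  define i where "i = (k + int m - 1) mod (2 * int m) - (int m - 1)"
  have "0 \<le> (k + int m - 1) mod (2 * int m)" "(k + int m - 1) mod (2 * int m) < 2 * int m"
    using m_pos by simp_all
  then have "i \<in> exponents m"
    by (auto simp: exponents_def i_def)
  moreover have "2 * int m dvd k - i"
    using dvd_minus_mod[of "2 * int m" "k + int m - 1"] by (simp add: i_def algebra_simps)
  then have "S #> x = \<alpha> [^]\<^bsub>G Mod S\<^esub> i"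
    unfolding k \<alpha>_pow_eq_iff by (simp add: dvd_diff_commute)
  then have "x \<in> \<alpha> [^]\<^bsub>G Mod S\<^esub> i"
    using mem_own_coset[OF S_normal x] by simp
  ultimately show ?thesis by blast
qed

lemma e_eqI:
  assumes x: "x \<in> carrier G" and i: "i \<in> exponents m" "x \<in> \<alpha> [^]\<^bsub>G Mod S\<^esub> i"
  shows "e x = i"
  unfolding coset_exponent_def
proof (rule the_equality)
  show "j = i" if "j \<in> exponents m \<and> x \<in> \<alpha> [^]\<^bsub>G Mod S\<^esub> j" for j
    using that i coset_eq_\<alpha>_pow[OF x, of i] coset_eq_\<alpha>_pow[OF x, of j] \<alpha>_pow_eq_iff[of i j]
    by (intro exponents_eqI[of j m i]) simp_all
qed (use i in simp)

lemma e_in_exponents [simp]: "x \<in> carrier G \<Longrightarrow> e x \<in> exponents m"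
  and \<alpha>_pow_e: "x \<in> carrier G \<Longrightarrow> \<alpha> [^]\<^bsub>G Mod S\<^esub> e x = S #> x"
  using exponent_exists[of x] e_eqI[of x] coset_eq_\<alpha>_pow[of x "e x"] by auto

lemma e_eq_iff:
  assumes x: "x \<in> carrier G" and y: "y \<in> carrier G"
  shows "e x = e y \<longleftrightarrow> S #> x = S #> y"
proof
  show "S #> x = S #> y" if "e x = e y"
    using that \<alpha>_pow_e[OF x] \<alpha>_pow_e[OF y] by simp
  show "e x = e y" if "S #> x = S #> y"
    using e_eqI[OF x e_in_exponents[OF y]] \<alpha>_pow_e[OF y] that mem_own_coset[OF S_normal x] by simp
qed

text \<open>Both e x + e y and e (x y) are exponents of the coset of x y, hence congruent modulo 2m;
  \<open>sigma\<close> gives the exact difference.\<close>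

lemma add_e:
  assumes x: "x \<in> carrier G" and y: "y \<in> carrier G"
  shows "e x + e y = e (x \<otimes> y) + 2 * int m * carry x y"
proof (rule add_exponents_eq)
  have "\<alpha> [^]\<^bsub>G Mod S\<^esub> (e x + e y) = (S #> x) \<otimes>\<^bsub>G Mod S\<^esub> (S #> y)"
    using x y \<alpha> by (simp only: K.int_pow_mult \<alpha>_pow_e)
  also have "\<dots> = \<alpha> [^]\<^bsub>G Mod S\<^esub> e (x \<otimes> y)"
    using x y by (simp add: set_mult_cosets[OF S_normal] \<alpha>_pow_e)
  finally show "2 * int m dvd e x + e y - e (x \<otimes> y)"
    by (simp add: \<alpha>_pow_eq_iff dvd_diff_commute)
qed (use x y in simp_all)

lemma e_mult_cong:
  assumes "x \<in> carrier G" "y \<in> carrier G" "x' \<in> carrier G" "y' \<in> carrier G" "e x = e x'" "e y = e y'"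
  shows "e (x \<otimes> y) = e (x' \<otimes> y')"
  using add_e[of x y] add_e[of x' y'] assms by simp

text \<open>\<open>G Mod S\<close> is a group, so bracketings that differ in \<open>G\<close> still
  lie in the same coset of \<open>S\<close>.\<close>

lemma e_assoc:
  assumes "x \<in> carrier G" "y \<in> carrier G" "z \<in> carrier G"
  shows "e ((x \<otimes> y) \<otimes> z) = e (x \<otimes> (y \<otimes> z))"
proof -
  have "S #> ((x \<otimes> y) \<otimes> z) = S #> (x \<otimes> (y \<otimes> z))"
    using K.m_assoc[of "S #> x" "S #> y" "S #> z"] assms
    by (simp add: coset_in_K set_mult_cosets[OF S_normal])
  then show ?thesis
    using assms by (simp add: e_eq_iff)
qed

text \<open>The zeroth power of \<open>\<alpha>\<close> is \<open>S\<close>, and 0 belongs to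
  \<open>exponents m\<close> because m \<ge> 1.\<close>

lemma e_S [simp]: "s \<in> S \<Longrightarrow> e s = 0"
  using m_pos coset_of_member[OF S_normal, of s] mem_own_coset[OF S_normal, of s]
  by (intro e_eqI) (simp_all add: exponents_def l_coset_eq_r_coset[OF S_normal])

lemma e_eq_0_imp_S: "\<lbrakk>x \<in> carrier G; e x = 0\<rbrakk> \<Longrightarrow> x \<in> S"
  using \<alpha>_pow_e[of x] mem_own_coset[OF S_normal, of x] by simp

lemma e_mult_S [simp]:
  assumes "x \<in> carrier G" "s \<in> S"
  shows "e (x \<otimes> s) = e x"
  using add_e[of x s] assms by simp

lemma carry_cocycle:
  assumes "x \<in> carrier G" "y \<in> carrier G" "z \<in> carrier G"
  shows "carry x y + carry (x \<otimes> y) z = carry y z + carry x (y \<otimes> z)"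
proof -
  have "2 * int m * (carry x y + carry (x \<otimes> y) z) = 2 * int m * (carry y z + carry x (y \<otimes> z))"
    using add_e[of x y] add_e[of "x \<otimes> y" z] add_e[of y z] add_e[of x "y \<otimes> z"] e_assoc[OF assms] assms
    by (simp add: distrib_left)
  then show ?thesis
    using m_pos by simp
qed

text \<open>The two complete products are equal in \<open>G\<close> itself by the Moufang law, so
  their exponents agree at once and the intermediate exponents cancel on each side.\<close>

lemma carry_moufang:
  assumes "x \<in> carrier G" "y \<in> carrier G" "z \<in> carrier G"
  shows "carry x y + carry (x \<otimes> y) x + carry ((x \<otimes> y) \<otimes> x) z =
    carry x z + carry y (x \<otimes> z) + carry x (y \<otimes> (x \<otimes> z))"
proof -
  have "2 * int m * (carry x y + carry (x \<otimes> y) x + carry ((x \<otimes> y) \<otimes> x) z) =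
      2 * int m * (carry x z + carry y (x \<otimes> z) + carry x (y \<otimes> (x \<otimes> z)))"
    using add_e[of x y] add_e[of "x \<otimes> y" x] add_e[of "(x \<otimes> y) \<otimes> x" z] add_e[of x z]
      add_e[of y "x \<otimes> z"] add_e[of x "y \<otimes> (x \<otimes> z)"] moufang[OF assms] assms
    by (simp add: distrib_left)
  then show ?thesis
    using m_pos by simp
qed

lemma h_pow_central [simp]: "h [^] (k::int) \<in> loop_center G"
  by (rule center_int_pow_in_center[OF h_central])

lemma h_pow_S [simp]: "h [^] (k::int) \<in> S"
  using subloop_generated_by_least[OF S_subloop, of "{h}"] h_in_S
  by (auto simp: subloop_generated_by_center[OF h_central])

lemmas h_pow_add = center_int_pow_mult[OF h_central]

text \<open>Both bracketings lie in the same coset of \<open>S\<close>; cancelling it in the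
  quotient sends the associator to the unit coset.\<close>

lemma associator_in_S:
  assumes "x \<in> carrier G" "y \<in> carrier G" "z \<in> carrier G"
  shows "associator G x y z \<in> S"
proof (rule e_eq_0_imp_S)
  let ?w = "associator G x y z"
  have "S #> ((x \<otimes> (y \<otimes> z)) \<otimes> ?w) = S #> ((x \<otimes> (y \<otimes> z)) \<otimes> \<one>)"
    using assms e_assoc[OF assms] by (simp add: e_eq_iff flip: mult_associator)
  then have "S #> ?w = S #> \<one>"
    by (rule coset_left_cancel[OF S_normal, rotated 3]) (use assms in simp_all)
  then have "e ?w = e \<one>"
    using assms by (simp add: e_eq_iff del: coset_one)
  then show "e ?w = 0"
    using subloop_one[OF S_subloop] by simp
qed (use assms in simp)

section \<open>The modified loop and its associators\<close>

lemma Gs_simps [simp]: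
  "carrier Gs = carrier G" "\<one>\<^bsub>Gs\<^esub> = \<one>"
  by (simp_all add: cyclic_construction_def)

lemma Gs_mult: "x \<otimes>\<^bsub>Gs\<^esub> y = (x \<otimes> y) \<otimes> h [^] carry x y"
  by (simp add: cyclic_construction_def)

text \<open>An element of \<open>S\<close> has exponent 0 and e x already lies in
  \<open>exponents m\<close>, so no carry arises. This is what makes associators, subloops inside
  \<open>S\<close> and cosets of \<open>A\<close> common to both products.\<close>

lemma Gs_mult_S:
  assumes "x \<in> carrier G" "s \<in> S"
  shows "x \<otimes>\<^bsub>Gs\<^esub> s = x \<otimes> s" and "s \<otimes>\<^bsub>Gs\<^esub> x = s \<otimes> x"
  using assms by (simp_all add: Gs_mult)

lemma Gs_mult_closed [simp]: "\<lbrakk>x \<in> carrier G; y \<in> carrier G\<rbrakk> \<Longrightarrow> x \<otimes>\<^bsub>Gs\<^esub> y \<in> carrier G"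
  by (simp add: Gs_mult)

lemma e_Gs_mult [simp]: "\<lbrakk>x \<in> carrier G; y \<in> carrier G\<rbrakk> \<Longrightarrow> e (x \<otimes>\<^bsub>Gs\<^esub> y) = e (x \<otimes> y)"
  by (simp add: Gs_mult)

text \<open>A power of \<open>h\<close> has exponent 0 and is central: it leaves the carry alone and
  can be moved to the end. Repeated use evaluates a bracketed word of \<open>Gs\<close> as the same
  word of \<open>G\<close> times one power of \<open>h\<close>.\<close>

lemma Gs_mult_h_pow:
  assumes "x \<in> carrier G" "y \<in> carrier G"
  shows "(x \<otimes> h [^] (k::int)) \<otimes>\<^bsub>Gs\<^esub> y = (x \<otimes> y) \<otimes> h [^] (k + carry x y)"
    and "x \<otimes>\<^bsub>Gs\<^esub> (y \<otimes> h [^] k) = (x \<otimes> y) \<otimes> h [^] (k + carry x y)"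
proof -
  have "((x \<otimes> y) \<otimes> h [^] k) \<otimes> h [^] c = (x \<otimes> y) \<otimes> h [^] (k + c)" for c :: int
    using assms loop_center_assoc_right[OF h_pow_central[of c], of "x \<otimes> y" "h [^] k"]
    by (simp add: h_pow_add)
  then show "(x \<otimes> h [^] k) \<otimes>\<^bsub>Gs\<^esub> y = (x \<otimes> y) \<otimes> h [^] (k + carry x y)"
    and "x \<otimes>\<^bsub>Gs\<^esub> (y \<otimes> h [^] k) = (x \<otimes> y) \<otimes> h [^] (k + carry x y)"
    using assms by (simp_all add: Gs_mult mult_central_right[OF h_pow_central assms])
qed

lemma Gs_mult3:
  assumes "x \<in> carrier G" "y \<in> carrier G" "z \<in> carrier G"
  shows "(x \<otimes>\<^bsub>Gs\<^esub> y) \<otimes>\<^bsub>Gs\<^esub> z = ((x \<otimes> y) \<otimes> z) \<otimes> h [^] (carry x y + carry (x \<otimes> y) z)"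
    and "x \<otimes>\<^bsub>Gs\<^esub> (y \<otimes>\<^bsub>Gs\<^esub> z) = (x \<otimes> (y \<otimes> z)) \<otimes> h [^] (carry y z + carry x (y \<otimes> z))"
  using assms by (simp_all only: Gs_mult[of x y] Gs_mult[of y z] Gs_mult_h_pow mult_closed)

text \<open>The power of \<open>h\<close> depends on the factor to be compared, so cancellation in
  \<open>G\<close> does not apply at once. Comparing exponents and cancelling in
  \<open>G Mod S\<close> first gives e x = e y, after which both powers are equal.\<close>

lemma Gs_left_cancel:
  assumes a: "a \<in> carrier G" and x: "x \<in> carrier G" and y: "y \<in> carrier G"
    and eq: "a \<otimes>\<^bsub>Gs\<^esub> x = a \<otimes>\<^bsub>Gs\<^esub> y"
  shows "x = y"
proof -
  have "e (a \<otimes> x) = e (a \<otimes> y)"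
    using arg_cong[OF eq, of e] a x y by simp
  then have "S #> x = S #> y"
    using a x y by (intro coset_left_cancel[OF S_normal a x y]) (simp add: e_eq_iff)
  then have "e x = e y"
    using x y by (simp add: e_eq_iff)
  with eq have "(a \<otimes> x) \<otimes> h [^] carry a x = (a \<otimes> y) \<otimes> h [^] carry a x"
    by (simp add: Gs_mult)
  then show ?thesis
    using a x y by simp
qed

lemma Gs_right_cancel:
  assumes a: "a \<in> carrier G" and x: "x \<in> carrier G" and y: "y \<in> carrier G"
    and eq: "x \<otimes>\<^bsub>Gs\<^esub> a = y \<otimes>\<^bsub>Gs\<^esub> a"
  shows "x = y"
proof -
  have "e (x \<otimes> a) = e (y \<otimes> a)"
    using arg_cong[OF eq, of e] a x y by simp
  then have "S #> x = S #> y"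
    using a x y by (intro coset_right_cancel[OF S_normal a x y]) (simp add: e_eq_iff)
  then have "e x = e y"
    using x y by (simp add: e_eq_iff)
  with eq have "(x \<otimes> a) \<otimes> h [^] carry x a = (y \<otimes> a) \<otimes> h [^] carry x a"
    by (simp add: Gs_mult)
  then show ?thesis
    using a x y by simp
qed

lemma loop_Gs: "loop Gs"
proof
  show "x \<otimes>\<^bsub>Gs\<^esub> y \<in> carrier Gs" if "x \<in> carrier Gs" "y \<in> carrier Gs" for x y
    using that by simp
  show "\<one>\<^bsub>Gs\<^esub> \<in> carrier Gs" by simp
  show "\<one>\<^bsub>Gs\<^esub> \<otimes>\<^bsub>Gs\<^esub> x = x" "x \<otimes>\<^bsub>Gs\<^esub> \<one>\<^bsub>Gs\<^esub> = x" if "x \<in> carrier Gs" for x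
    using that subloop_one[OF S_subloop] by (simp_all add: Gs_mult_S)
next
  fix a b assume "a \<in> carrier Gs" "b \<in> carrier Gs"
  then have a: "a \<in> carrier G" and b: "b \<in> carrier G" by simp_all
  obtain x where x: "x \<in> carrier G" "a \<otimes> x = b"
    using left_quotient_exists a b by blast
  \<comment> \<open>The quotient in \<open>G\<close> is corrected by a power of \<open>h\<close>;
    this does not change the carry with \<open>a\<close>, which it cancels.\<close>
  have "x \<otimes> h [^] (- carry a x) \<in> carrier Gs \<and> a \<otimes>\<^bsub>Gs\<^esub> (x \<otimes> h [^] (- carry a x)) = b"
    using a b x by (simp add: Gs_mult_h_pow)
  then show "\<exists>!x. x \<in> carrier Gs \<and> a \<otimes>\<^bsub>Gs\<^esub> x = b"
    using Gs_left_cancel a by (intro ex1I) auto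
  obtain y where y: "y \<in> carrier G" "y \<otimes> a = b"
    using right_quotient_exists a b by blast
  have "y \<otimes> h [^] (- carry y a) \<in> carrier Gs \<and> (y \<otimes> h [^] (- carry y a)) \<otimes>\<^bsub>Gs\<^esub> a = b"
    using a b y by (simp add: Gs_mult_h_pow)
  then show "\<exists>!x. x \<in> carrier Gs \<and> x \<otimes>\<^bsub>Gs\<^esub> a = b"
    using Gs_right_cancel a by (intro ex1I) auto
qed

lemma moufang_loop_Gs: "moufang_loop Gs"
proof (rule moufang_loopI[OF loop_Gs])
  fix x y z assume "x \<in> carrier Gs" "y \<in> carrier Gs" "z \<in> carrier Gs"
  then have x: "x \<in> carrier G" and y: "y \<in> carrier G" and z: "z \<in> carrier G" by simp_all
  have "((x \<otimes>\<^bsub>Gs\<^esub> y) \<otimes>\<^bsub>Gs\<^esub> x) \<otimes>\<^bsub>Gs\<^esub> z =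
      (((x \<otimes> y) \<otimes> x) \<otimes> z) \<otimes> h [^] (carry x y + carry (x \<otimes> y) x + carry ((x \<otimes> y) \<otimes> x) z)"
    using x y z by (simp only: Gs_mult3 Gs_mult_h_pow mult_closed)
  also have "\<dots> = (x \<otimes> (y \<otimes> (x \<otimes> z))) \<otimes>
      h [^] (carry x z + carry y (x \<otimes> z) + carry x (y \<otimes> (x \<otimes> z)))"
    using x y z by (simp only: moufang carry_moufang)
  also have "\<dots> = x \<otimes>\<^bsub>Gs\<^esub> (y \<otimes>\<^bsub>Gs\<^esub> (x \<otimes>\<^bsub>Gs\<^esub> z))"
    using x y z by (simp only: Gs_mult3 Gs_mult_h_pow mult_closed)
  finally show "((x \<otimes>\<^bsub>Gs\<^esub> y) \<otimes>\<^bsub>Gs\<^esub> x) \<otimes>\<^bsub>Gs\<^esub> z = x \<otimes>\<^bsub>Gs\<^esub> (y \<otimes>\<^bsub>Gs\<^esub> (x \<otimes>\<^bsub>Gs\<^esub> z))" .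
qed

sublocale Gs: moufang_loop Gs
  rewrites "carrier Gs = carrier G" and "\<one>\<^bsub>Gs\<^esub> = \<one>"
  by (rule moufang_loop_Gs) simp_all

lemma associator_Gs:
  assumes x: "x \<in> carrier G" and y: "y \<in> carrier G" and z: "z \<in> carrier G"
  shows "associator Gs x y z = associator G x y z"
proof (rule Gs.associator_eqI)
  let ?w = "associator G x y z" and ?c = "h [^] (carry y z + carry x (y \<otimes> z))"
  have "(x \<otimes>\<^bsub>Gs\<^esub> y) \<otimes>\<^bsub>Gs\<^esub> z = ((x \<otimes> y) \<otimes> z) \<otimes> ?c"
    using assms by (simp add: Gs_mult3 carry_cocycle)
  also have "\<dots> = ((x \<otimes> (y \<otimes> z)) \<otimes> ?w) \<otimes> ?c"
    by (simp only: mult_associator[OF assms])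
  also have "\<dots> = ((x \<otimes> (y \<otimes> z)) \<otimes> ?c) \<otimes> ?w"
    using assms by (simp add: mult_central_right(1)[OF h_pow_central])
  \<comment> \<open>Since \<open>?w\<close> lies in \<open>S\<close>, multiplying by it means the
    same in both loops.\<close>
  also have "\<dots> = (x \<otimes>\<^bsub>Gs\<^esub> (y \<otimes>\<^bsub>Gs\<^esub> z)) \<otimes>\<^bsub>Gs\<^esub> ?w"
    using assms associator_in_S[OF assms] by (simp add: Gs_mult3 Gs_mult_S)
  finally show "(x \<otimes>\<^bsub>Gs\<^esub> y) \<otimes>\<^bsub>Gs\<^esub> z = (x \<otimes>\<^bsub>Gs\<^esub> (y \<otimes>\<^bsub>Gs\<^esub> z)) \<otimes>\<^bsub>Gs\<^esub> ?w" .
qed (use assms in simp_all)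

lemma subloop_Gs_iff:
  assumes "H \<subseteq> S"
  shows "subloop H Gs \<longleftrightarrow> subloop H G"
proof
  have eq: "x \<otimes>\<^bsub>Gs\<^esub> z = x \<otimes> z" "z \<otimes>\<^bsub>Gs\<^esub> x = z \<otimes> x" if "x \<in> H" "z \<in> carrier G" for x z
    using that assms by (auto simp: Gs_mult_S)
  show "subloop H Gs" if "subloop H G"
    using that by (rule subloop_transfer) (simp_all add: eq)
  show "subloop H G" if "subloop H Gs"
    using that by (rule subloop_transfer) (simp_all add: eq)
qed

lemma nucleus_Gs: "nucleus Gs = nucleus G"
  unfolding nucleus_def by (auto simp: associator_Gs)

lemma associators_Gs:
  "{associator Gs x y z |x y z. x \<in> carrier Gs \<and> y \<in> carrier Gs \<and> z \<in> carrier Gs} =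
    {associator G x y z |x y z. x \<in> carrier G \<and> y \<in> carrier G \<and> z \<in> carrier G}"
  using associator_Gs by auto metis+

lemma associator_subloop_subset: "associator_subloop G \<subseteq> S"
  unfolding associator_subloop_def
  by (rule subloop_generated_by_least[OF S_subloop]) (auto simp: associator_in_S)

lemma associator_subloop_Gs: "associator_subloop Gs = associator_subloop G"
proof
  let ?X = "{associator G x y z |x y z. x \<in> carrier G \<and> y \<in> carrier G \<and> z \<in> carrier G}"
  have X: "?X \<subseteq> S" "?X \<subseteq> carrier G"
    by (auto simp: associator_in_S)
  have Gs: "associator_subloop Gs = subloop_generated_by Gs ?X"
    unfolding associator_subloop_def associators_Gs ..
  have "subloop (associator_subloop G) G"
    unfolding associator_subloop_def by (rule subloop_generated_by_subloop[OF X(2)])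
  then have "subloop (associator_subloop G) Gs"
    using subloop_Gs_iff[OF associator_subloop_subset] by simp
  then show "associator_subloop Gs \<subseteq> associator_subloop G"
    unfolding Gs by (rule subloop_generated_by_least)
      (simp add: associator_subloop_def subset_subloop_generated_by)
  \<comment> \<open>Only subsets of \<open>S\<close> can be moved between the loops by
    \<open>subloop_Gs_iff\<close>, so the subloop generated in \<open>Gs\<close> is first bounded by
    \<open>S\<close>.\<close>
  have "associator_subloop Gs \<subseteq> S"
    unfolding Gs using subloop_Gs_iff[of S] S_subloop X(1) by (intro subloop_generated_by_least) simp_all
  moreover have "subloop (associator_subloop Gs) Gs"
    unfolding Gs using X(2) by (rule Gs.subloop_generated_by_subloop)
  ultimately have "subloop (associator_subloop Gs) G"
    using subloop_Gs_iff by simp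
  then show "associator_subloop G \<subseteq> associator_subloop Gs"
    unfolding associator_subloop_def[of G] by (rule subloop_generated_by_least)
      (simp add: Gs subset_subloop_generated_by)
qed

section \<open>The common quotient by the subloop generated by \<open>h\<close>\<close>

abbreviation A :: "'a set"
  where "A \<equiv> subloop_generated_by G {h}"

lemma A_eq: "A = range (\<lambda>k::int. h [^] k)"
  by (rule subloop_generated_by_center[OF h_central])

lemma A_subloop: "subloop A G"
  by (rule subloop_generated_by_subloop) simp

lemma A_central: "A \<subseteq> loop_center G"
  unfolding A_eq by auto

lemma A_subset_S: "A \<subseteq> S"
  unfolding A_eq by auto

lemma A_normal: "normal_subloop A G"
  by (rule normal_subloop_central[OF A_subloop A_central])

text \<open>Centrality passes to \<open>Gs\<close>: elements of \<open>A\<close> lie in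
  \<open>S\<close>, so their products with other elements are unchanged, and their associators are
  unchanged by \<open>associator_Gs\<close>.\<close>

lemma A_normal_Gs: "normal_subloop A Gs"
proof (rule Gs.normal_subloop_central)
  show "subloop A Gs"
    using subloop_Gs_iff[OF A_subset_S] A_subloop by simp
  show "A \<subseteq> loop_center Gs"
  proof
    fix c assume "c \<in> A"
    then have cS: "c \<in> S" and c: "c \<in> loop_center G"
      using A_subset_S A_central by auto
    show "c \<in> loop_center Gs"
      unfolding Gs.loop_center_iff
    proof (intro conjI ballI)
      show "c \<in> carrier G" using cS by simp
      fix y z assume y: "y \<in> carrier G" and z: "z \<in> carrier G"
      show "c \<otimes>\<^bsub>Gs\<^esub> y = y \<otimes>\<^bsub>Gs\<^esub> c"
        using y cS by (simp add: Gs_mult_S loop_center_comm[OF c y])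
      have "associator Gs c y z = \<one>"
        using cS y z by (simp add: associator_Gs associator_eq_one_iff loop_center_assoc_left[OF c])
      then show "(c \<otimes>\<^bsub>Gs\<^esub> y) \<otimes>\<^bsub>Gs\<^esub> z = c \<otimes>\<^bsub>Gs\<^esub> (y \<otimes>\<^bsub>Gs\<^esub> z)"
        using cS y z by (simp add: Gs.associator_eq_one_iff)
    qed
  qed
qed

lemma r_coset_Gs: "x \<in> carrier G \<Longrightarrow> A #>\<^bsub>Gs\<^esub> x = A #> x"
  unfolding r_coset_def using A_subset_S by (intro SUP_cong refl) (auto simp: Gs_mult_S)

lemma carrier_Gs_Mod: "carrier (Gs Mod A) = carrier (G Mod A)"
  by (simp add: carrier_FactGroup r_coset_Gs cong: image_cong_simp)

text \<open>The two products of representatives differ by a power of \<open>h\<close>, which a coset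
  of \<open>A\<close> absorbs.\<close>

lemma mult_Gs_Mod:
  assumes "X \<in> carrier (G Mod A)" "Y \<in> carrier (G Mod A)"
  shows "X \<otimes>\<^bsub>Gs Mod A\<^esub> Y = X \<otimes>\<^bsub>G Mod A\<^esub> Y"
proof -
  obtain x y where x: "x \<in> carrier G" "X = A #> x" and y: "y \<in> carrier G" "Y = A #> y"
    using assms by (auto simp: carrier_FactGroup)
  have "(x \<otimes> y) \<otimes> h [^] carry x y \<in> (x \<otimes> y) <# A"
    by (auto simp: l_coset_def A_eq)
  then have "A #> (x \<otimes>\<^bsub>Gs\<^esub> y) = A #> (x \<otimes> y)"
    using x y by (intro coset_eqI[OF A_normal]) (simp_all add: Gs_mult l_coset_eq_r_coset[OF A_normal])
  moreover have "(A #>\<^bsub>Gs\<^esub> x) <#>\<^bsub>Gs\<^esub> (A #>\<^bsub>Gs\<^esub> y) = A #>\<^bsub>Gs\<^esub> (x \<otimes>\<^bsub>Gs\<^esub> y)"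
    by (rule Gs.set_mult_cosets[OF A_normal_Gs x(1) y(1)])
  ultimately show ?thesis
    using x y by (simp add: r_coset_Gs set_mult_cosets[OF A_normal])
qed

end

section \<open>The factor set given by the carry\<close>

context cyclic_setting
begin

context
  fixes \<pi> :: "'a set \<Rightarrow> 'a"
  assumes \<pi>: "\<And>X. X \<in> carrier (G Mod A) \<Longrightarrow> \<pi> X \<in> X"
begin

text \<open>Since \<open>A\<close> lies in \<open>S\<close>, the exponent is constant on cosets of
  \<open>A\<close>; it descends to the quotient and may be read off the transversal.\<close>

lemma e_coset:
  assumes X: "X \<in> carrier (G Mod A)" and x: "x \<in> X"
  shows "x \<in> carrier G" and "X = x <# A" and "e (\<pi> X) = e x"
proof -
  obtain x0 where x0: "x0 \<in> carrier G" "X = A #> x0"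
    using X by (auto simp: carrier_FactGroup)
  show xG: "x \<in> carrier G"
    using x x0 coset_subset[OF A_normal] by blast
  show X_eq: "X = x <# A"
    using coset_eqI[OF A_normal, of x0 x] x x0 xG by (simp add: l_coset_eq_r_coset[OF A_normal])
  have "\<pi> X \<in> x <# A"
    using \<pi>[OF X] X_eq by simp
  then obtain k :: int where "\<pi> X = x \<otimes> h [^] k"
    by (auto simp: l_coset_def A_eq)
  then show "e (\<pi> X) = e x"
    using xG by simp
qed

lemma transversal_closed: "X \<in> carrier (G Mod A) \<Longrightarrow> \<pi> X \<in> carrier G"
  using e_coset(1) \<pi> by blast

lemma e_transversal_mult:
  assumes X: "X \<in> carrier (G Mod A)" and Y: "Y \<in> carrier (G Mod A)"
  shows "e (\<pi> (X \<otimes>\<^bsub>G Mod A\<^esub> Y)) = e (\<pi> X \<otimes> \<pi> Y)"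
proof (rule e_coset(3))
  interpret Q: moufang_loop "G Mod A" by (rule moufang_loop_Mod[OF A_normal])
  show "X \<otimes>\<^bsub>G Mod A\<^esub> Y \<in> carrier (G Mod A)"
    by (rule Q.mult_closed[OF X Y])
  show "\<pi> X \<otimes> \<pi> Y \<in> X \<otimes>\<^bsub>G Mod A\<^esub> Y"
    using \<pi>[OF X] \<pi>[OF Y] by (auto simp: set_mult_def)
qed

text \<open>This is the intended difference of the two factor sets. Evaluating the carry at the
  transversal turns it into a function of cosets; by \<open>e_coset\<close> any other
  representatives give the same value.\<close>

abbreviation \<mu> :: "'a set \<Rightarrow> 'a set \<Rightarrow> 'a"
  where "\<mu> X Y \<equiv> h [^] carry (\<pi> X) (\<pi> Y)"

text \<open>The cocycle identities are those of the carry. For the last claim, u (v w) and (u v) w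
  may differ in the quotient but have the same exponent, so both sides are \<open>h\<close> to the
  power \<open>sigma\<close> of the same two exponents, added in opposite orders.\<close>

lemma carry_factor_set:
  shows associative_factor_set_carry:
      "associative_factor_set (G Mod A) (G\<lparr>carrier := A\<rparr>) (trivial_action (G\<lparr>carrier := A\<rparr>)) \<mu>"
    and moufang_factor_set_carry:
      "moufang_factor_set (G Mod A) (G\<lparr>carrier := A\<rparr>) (trivial_action (G\<lparr>carrier := A\<rparr>)) \<mu>"
    and carry_assoc_inv:
      "\<lbrakk>u \<in> carrier (G Mod A); v \<in> carrier (G Mod A); w \<in> carrier (G Mod A)\<rbrakk> \<Longrightarrow>
       \<mu> (inv\<^bsub>G Mod A\<^esub> (u \<otimes>\<^bsub>G Mod A\<^esub> (v \<otimes>\<^bsub>G Mod A\<^esub> w))) ((u \<otimes>\<^bsub>G Mod A\<^esub> v) \<otimes>\<^bsub>G Mod A\<^esub> w) =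
       trivial_action (G\<lparr>carrier := A\<rparr>) ((u \<otimes>\<^bsub>G Mod A\<^esub> v) \<otimes>\<^bsub>G Mod A\<^esub> w)
         (\<mu> (u \<otimes>\<^bsub>G Mod A\<^esub> (v \<otimes>\<^bsub>G Mod A\<^esub> w)) (inv\<^bsub>G Mod A\<^esub> (u \<otimes>\<^bsub>G Mod A\<^esub> (v \<otimes>\<^bsub>G Mod A\<^esub> w))))"
proof -
  let ?Q = "G Mod A" and ?A = "G\<lparr>carrier := A\<rparr>"
  interpret Q: moufang_loop ?Q by (rule moufang_loop_Mod[OF A_normal])
  note closed = transversal_closed
  note e_mult = e_transversal_mult[simplified mult_FactGroup]
  note Q_closed = Q.mult_closed[simplified mult_FactGroup]
  have in_A: "h [^] (k::int) \<in> A" for k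
    by (simp add: A_eq)
  \<comment> \<open>\<open>\<pi> A\<close> lies in \<open>A\<close> and hence in \<open>S\<close>;
    exponent 0 produces no carry, which is the normalization of \<open>\<mu>\<close>.\<close>
  have e_one: "e (\<pi> A) = 0"
    using \<pi>[of A] A_subset_S Q.one_in_carrier by auto
  have fs: "factor_set ?Q ?A (trivial_action ?A) \<mu>"
    by (rule trivial_factor_setI)
      (simp_all add: Q.moufang_loop_axioms comm_group_central_subloop[OF A_subloop A_central] in_A
        e_one closed)
  show "associative_factor_set ?Q ?A (trivial_action ?A) \<mu>"
  proof (rule trivial_associative_factor_setI[OF fs])
    fix X Y Z assume X: "X \<in> carrier ?Q" and Y: "Y \<in> carrier ?Q" and Z: "Z \<in> carrier ?Q"
    show "\<mu> X Y \<otimes>\<^bsub>?A\<^esub> \<mu> (X \<otimes>\<^bsub>?Q\<^esub> Y) Z = \<mu> Y Z \<otimes>\<^bsub>?A\<^esub> \<mu> X (Y \<otimes>\<^bsub>?Q\<^esub> Z)"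
      using carry_cocycle[OF closed[OF X] closed[OF Y] closed[OF Z]]
      by (simp add: X Y Z e_mult flip: h_pow_add)
  qed
  have "\<mu> X Y \<otimes> \<mu> (X \<otimes>\<^bsub>?Q\<^esub> Y) X \<otimes> \<mu> ((X \<otimes>\<^bsub>?Q\<^esub> Y) \<otimes>\<^bsub>?Q\<^esub> X) Z =
      \<mu> X Z \<otimes> \<mu> Y (X \<otimes>\<^bsub>?Q\<^esub> Z) \<otimes> \<mu> X (Y \<otimes>\<^bsub>?Q\<^esub> (X \<otimes>\<^bsub>?Q\<^esub> Z))"
    if X: "X \<in> carrier ?Q" and Y: "Y \<in> carrier ?Q" and Z: "Z \<in> carrier ?Q" for X Y Z
  proof -
    \<comment> \<open>\<open>e_mult\<close> compares transversal values across one product;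
      \<open>e_mult_cong\<close> carries the comparison of the inner product through the outer
      factor.\<close>
    have "e (\<pi> ((X \<otimes>\<^bsub>?Q\<^esub> Y) \<otimes>\<^bsub>?Q\<^esub> X)) = e ((\<pi> X \<otimes> \<pi> Y) \<otimes> \<pi> X)"
      using e_mult[OF Q_closed[OF X Y] X] e_mult[OF X Y]
        e_mult_cong[of "\<pi> (X <#> Y)" "\<pi> X" "\<pi> X \<otimes> \<pi> Y" "\<pi> X"]
      by (simp add: closed X Y Q_closed)
    moreover have "e (\<pi> (Y \<otimes>\<^bsub>?Q\<^esub> (X \<otimes>\<^bsub>?Q\<^esub> Z))) = e (\<pi> Y \<otimes> (\<pi> X \<otimes> \<pi> Z))"
      using e_mult[OF Y Q_closed[OF X Z]] e_mult[OF X Z]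
        e_mult_cong[of "\<pi> Y" "\<pi> (X <#> Z)" "\<pi> Y" "\<pi> X \<otimes> \<pi> Z"]
      by (simp add: closed X Y Z Q_closed)
    ultimately show ?thesis
      using carry_moufang[OF closed[OF X] closed[OF Y] closed[OF Z]]
      by (simp add: e_mult X Y Z flip: h_pow_add)
  qed
  then show "moufang_factor_set ?Q ?A (trivial_action ?A) \<mu>"
    unfolding trivial_moufang_factor_set_iff using fs by simp
  assume u: "u \<in> carrier ?Q" and v: "v \<in> carrier ?Q" and w: "w \<in> carrier ?Q"
  have "e (\<pi> ((u \<otimes>\<^bsub>?Q\<^esub> v) \<otimes>\<^bsub>?Q\<^esub> w)) = e ((\<pi> u \<otimes> \<pi> v) \<otimes> \<pi> w)"
    using e_mult[OF Q_closed[OF u v] w] e_mult[OF u v]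
      e_mult_cong[of "\<pi> (u <#> v)" "\<pi> w" "\<pi> u \<otimes> \<pi> v" "\<pi> w"]
    by (simp add: closed u v w Q_closed)
  also have "\<dots> = e (\<pi> u \<otimes> (\<pi> v \<otimes> \<pi> w))"
    by (rule e_assoc) (simp_all add: closed u v w)
  also have "\<dots> = e (\<pi> (u \<otimes>\<^bsub>?Q\<^esub> (v \<otimes>\<^bsub>?Q\<^esub> w)))"
    using e_mult[OF u Q_closed[OF v w]] e_mult[OF v w]
      e_mult_cong[of "\<pi> u" "\<pi> (v <#> w)" "\<pi> u" "\<pi> v \<otimes> \<pi> w"]
    by (simp add: closed u v w Q_closed)
  finally show "\<mu> (inv\<^bsub>?Q\<^esub> (u \<otimes>\<^bsub>?Q\<^esub> (v \<otimes>\<^bsub>?Q\<^esub> w))) ((u \<otimes>\<^bsub>?Q\<^esub> v) \<otimes>\<^bsub>?Q\<^esub> w) =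
       trivial_action ?A ((u \<otimes>\<^bsub>?Q\<^esub> v) \<otimes>\<^bsub>?Q\<^esub> w)
         (\<mu> (u \<otimes>\<^bsub>?Q\<^esub> (v \<otimes>\<^bsub>?Q\<^esub> w)) (inv\<^bsub>?Q\<^esub> (u \<otimes>\<^bsub>?Q\<^esub> (v \<otimes>\<^bsub>?Q\<^esub> w))))"
    by (simp add: in_A add.commute)
qed

end

end

theorem theorem6p3:
  fixes G Gstar :: "('a, 'b) monoid_scheme"
    and S A :: "'a set" and m :: nat and \<alpha> :: "'a set" and h :: 'a
    and Q :: "'a set monoid" and Agrp :: "('a, 'b) monoid_scheme"
    and \<iota> :: "'a set \<Rightarrow> 'a \<Rightarrow> 'a"
    and \<pi> :: "'a set \<Rightarrow> 'a" and \<tau> :: "'a set \<Rightarrow> 'a set \<Rightarrow> int"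
    and \<eta> \<eta>star :: "'a set \<Rightarrow> 'a set \<Rightarrow> 'a"
  assumes C: "condition_C G S m \<alpha> h"
    and Gstar: "Gstar = cyclic_construction G S m \<alpha> h"
    and A: "A = subloop_generated_by G {h}"
    and Agrp: "Agrp = G\<lparr>carrier := A\<rparr>"
    and Q: "Q = G Mod A"
    and iota: "\<iota> = trivial_action Agrp"
    and transversal: "\<And>x. x \<in> carrier G \<Longrightarrow> \<pi> (x <#\<^bsub>G\<^esub> A) \<in> x <#\<^bsub>G\<^esub> A"
    and transversal_one: "\<pi> A = \<one>\<^bsub>G\<^esub>"
    and tau: "\<And>x y. \<lbrakk>x \<in> carrier G; y \<in> carrier G\<rbrakk> \<Longrightarrow>
      \<pi> ((x \<otimes>\<^bsub>G\<^esub> y) <#\<^bsub>G\<^esub> A) =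
        (\<pi> (x <#\<^bsub>G\<^esub> A) \<otimes>\<^bsub>G\<^esub> \<pi> (y <#\<^bsub>G\<^esub> A)) \<otimes>\<^bsub>G\<^esub> (h [^]\<^bsub>G\<^esub> \<tau> (x <#\<^bsub>G\<^esub> A) (y <#\<^bsub>G\<^esub> A))"
    and eta: "\<And>x y. \<lbrakk>x \<in> carrier G; y \<in> carrier G\<rbrakk> \<Longrightarrow>
      \<eta> (x <#\<^bsub>G\<^esub> A) (y <#\<^bsub>G\<^esub> A) = h [^]\<^bsub>G\<^esub> (- \<tau> (x <#\<^bsub>G\<^esub> A) (y <#\<^bsub>G\<^esub> A))"
    and etastar: "\<And>x y i j. \<lbrakk>i \<in> exponents m; j \<in> exponents m;
        x \<in> \<alpha> [^]\<^bsub>G Mod S\<^esub> i; y \<in> \<alpha> [^]\<^bsub>G Mod S\<^esub> j\<rbrakk> \<Longrightarrow>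
      \<eta>star (x <#\<^bsub>G\<^esub> A) (y <#\<^bsub>G\<^esub> A) =
        \<eta> (x <#\<^bsub>G\<^esub> A) (y <#\<^bsub>G\<^esub> A) \<otimes>\<^bsub>G\<^esub> (h [^]\<^bsub>G\<^esub> sigma m (i + j))"
  shows
    \<comment> \<open>\<open>A\<close> is normal in both loops and \<open>Q\<close> is the quotient of either by \<open>A\<close>;
       the records agree as loops, i.e. products are compared on the carrier\<close>
    "normal_subloop A G \<and> normal_subloop A Gstar \<and>
     carrier (Gstar Mod A) = carrier Q \<and> \<one>\<^bsub>Gstar Mod A\<^esub> = \<one>\<^bsub>Q\<^esub> \<and>
     (\<forall>X\<in>carrier Q. \<forall>Y\<in>carrier Q. X \<otimes>\<^bsub>Gstar Mod A\<^esub> Y = X \<otimes>\<^bsub>Q\<^esub> Y) \<and>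
     moufang_factor_set Q Agrp \<iota> \<eta> \<and> moufang_factor_set Q Agrp \<iota> \<eta>star \<and>
     (\<exists>\<mu>. associative_factor_set Q Agrp \<iota> \<mu> \<and>
        (\<forall>X\<in>carrier Q. \<forall>Y\<in>carrier Q. \<eta>star X Y = cocycle_sum Agrp \<eta> \<mu> X Y) \<and>
        (\<forall>u\<in>carrier Q. \<forall>v\<in>carrier Q. \<forall>w\<in>carrier Q.
           \<mu> (inv\<^bsub>Q\<^esub> (u \<otimes>\<^bsub>Q\<^esub> (v \<otimes>\<^bsub>Q\<^esub> w))) ((u \<otimes>\<^bsub>Q\<^esub> v) \<otimes>\<^bsub>Q\<^esub> w) =
           \<iota> ((u \<otimes>\<^bsub>Q\<^esub> v) \<otimes>\<^bsub>Q\<^esub> w)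
             (\<mu> (u \<otimes>\<^bsub>Q\<^esub> (v \<otimes>\<^bsub>Q\<^esub> w)) (inv\<^bsub>Q\<^esub> (u \<otimes>\<^bsub>Q\<^esub> (v \<otimes>\<^bsub>Q\<^esub> w)))))) \<and>
     moufang_loop Gstar \<and>
     (\<forall>x\<in>carrier G. \<forall>y\<in>carrier G. \<forall>z\<in>carrier G.
        associator G x y z = associator Gstar x y z) \<and>
     associator_subloop G = associator_subloop Gstar \<and>
     (\<forall>x\<in>associator_subloop G. \<forall>y\<in>associator_subloop G. x \<otimes>\<^bsub>G\<^esub> y = x \<otimes>\<^bsub>Gstar\<^esub> y) \<and>
     nucleus G = nucleus Gstar"
proof -
  interpret cyclic_setting G S m \<alpha> h
    using C condition_C_def[of G] by (blast intro: cyclic_setting.intro cyclic_setting_axioms.intro)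
  have \<pi>: "\<pi> X \<in> X" if "X \<in> carrier (G Mod subloop_generated_by G {h})" for X
    using that transversal
    by (auto simp: carrier_FactGroup A simp flip: l_coset_eq_r_coset[OF A_normal])
  have in_A: "h [^]\<^bsub>G\<^esub> (k::int) \<in> A" for k
    by (simp add: A A_eq)
  \<comment> \<open>The hypotheses speak of elements of \<open>G\<close> and the conclusions of
    cosets; taking \<open>\<pi> X\<close> as the representative of \<open>X\<close> lets the former
    be instantiated.\<close>
  have rep: "\<pi> X \<in> carrier G" "X = \<pi> X <#\<^bsub>G\<^esub> A" if "X \<in> carrier Q" for X
    using e_coset(1,2)[OF \<pi> _ \<pi>] that by (simp_all add: Q A)
  have mult: "X \<otimes>\<^bsub>Q\<^esub> Y = (\<pi> X \<otimes>\<^bsub>G\<^esub> \<pi> Y) <#\<^bsub>G\<^esub> A" if "X \<in> carrier Q" "Y \<in> carrier Q" for X Y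
  proof -
    have "X \<otimes>\<^bsub>Q\<^esub> Y = (\<pi> X <#\<^bsub>G\<^esub> A) \<otimes>\<^bsub>Q\<^esub> (\<pi> Y <#\<^bsub>G\<^esub> A)"
      using rep(2) that by simp
    then show ?thesis
      using rep(1) that by (simp add: Q A l_coset_eq_r_coset[OF A_normal] set_mult_cosets[OF A_normal])
  qed
  have \<eta>_eq: "\<eta> X Y = h [^]\<^bsub>G\<^esub> (- \<tau> X Y)" if "X \<in> carrier Q" "Y \<in> carrier Q" for X Y
    using eta[of "\<pi> X" "\<pi> Y"] rep that by simp
  have \<eta>: "moufang_factor_set Q Agrp \<iota> \<eta>"
    unfolding Q Agrp iota A
  proof (rule transversal_moufang_factor_set[OF A_subloop A_central])
    fix X Y assume "X \<in> carrier (G Mod subloop_generated_by G {h})"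
      and "Y \<in> carrier (G Mod subloop_generated_by G {h})"
    then have X: "X \<in> carrier Q" and Y: "Y \<in> carrier Q" by (simp_all add: Q A)
    show "\<eta> X Y \<in> subloop_generated_by G {h}"
      using \<eta>_eq[OF X Y] in_A by (simp add: A)
    \<comment> \<open>\<open>\<tau>\<close> leads from the product of the transversal values to the
      transversal value of the product. The correction in a factor set goes the other way, whence
      the negative exponent in \<open>\<eta>\<close>.\<close>
    have "\<pi> (X \<otimes>\<^bsub>Q\<^esub> Y) = (\<pi> X \<otimes>\<^bsub>G\<^esub> \<pi> Y) \<otimes>\<^bsub>G\<^esub> h [^]\<^bsub>G\<^esub> \<tau> X Y"
      using tau[OF rep(1)[OF X] rep(1)[OF Y]] rep(2)[OF X] rep(2)[OF Y] mult[OF X Y] by simp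
    then have "\<pi> (X \<otimes>\<^bsub>Q\<^esub> Y) \<otimes>\<^bsub>G\<^esub> \<eta> X Y = (\<pi> X \<otimes>\<^bsub>G\<^esub> \<pi> Y) \<otimes>\<^bsub>G\<^esub> (h [^]\<^bsub>G\<^esub> \<tau> X Y \<otimes>\<^bsub>G\<^esub> h [^]\<^bsub>G\<^esub> (- \<tau> X Y))"
      using rep(1)[OF X] rep(1)[OF Y] X Y
        loop_center_assoc_right[OF h_pow_central[of "- \<tau> X Y"],
          of "\<pi> X \<otimes>\<^bsub>G\<^esub> \<pi> Y" "h [^]\<^bsub>G\<^esub> \<tau> X Y"]
      by (simp add: \<eta>_eq)
    then show "\<pi> X \<otimes>\<^bsub>G\<^esub> \<pi> Y = \<pi> (X \<otimes>\<^bsub>G Mod subloop_generated_by G {h}\<^esub> Y) \<otimes>\<^bsub>G\<^esub> \<eta> X Y"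
      using rep(1) X Y by (simp add: Q A flip: h_pow_add)
  next
    show "\<pi> (subloop_generated_by G {h}) = \<one>\<^bsub>G\<^esub>"
      using transversal_one by (simp add: A)
  qed (use rep(1) Q A in simp)
  define \<mu> where "\<mu> X Y = h [^]\<^bsub>G\<^esub> sigma m (e (\<pi> X) + e (\<pi> Y))" for X Y
  note carry = carry_factor_set[OF \<pi>, folded \<mu>_def A, folded Q Agrp iota]
  have sum: "\<eta>star X Y = cocycle_sum Agrp \<eta> \<mu> X Y" if X: "X \<in> carrier Q" and Y: "Y \<in> carrier Q" for X Y
  proof -
    \<comment> \<open>The exponents of the transversal values supply the \<open>i\<close> and
      \<open>j\<close> at which \<open>etastar\<close> is used.\<close>
    have mem: "\<pi> X \<in> \<alpha> [^]\<^bsub>G Mod S\<^esub> e (\<pi> X)" if "X \<in> carrier Q" for X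
      using rep(1)[OF that] by (simp add: \<alpha>_pow_e mem_own_coset[OF S_normal])
    show ?thesis
      using etastar[OF _ _ mem[OF X] mem[OF Y]] rep(1)[OF X] rep(1)[OF Y]
        rep(2)[OF X, symmetric] rep(2)[OF Y, symmetric]
      by (simp add: cocycle_sum_def Agrp \<mu>_def)
  qed
  \<comment> \<open>\<open>carry(2)\<close> is the Moufang property of \<open>\<mu>\<close>, so this
    is a sum of two Moufang factor sets.\<close>
  have \<eta>star: "moufang_factor_set Q Agrp \<iota> \<eta>star"
    using moufang_factor_set_sum[OF \<eta>[unfolded iota] carry(2)[unfolded iota] sum] by (simp add: iota)
  \<comment> \<open>Inside \<open>S\<close> the two products agree, so this inclusion makes the
    associator subloops equal as loops and not just as sets.\<close>
  have S: "associator_subloop G \<subseteq> S"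
    by (rule associator_subloop_subset)
  show ?thesis
  proof (intro conjI ballI exI[of _ \<mu>] \<eta> \<eta>star carry sum)
    show "normal_subloop A G" "normal_subloop A Gstar" "moufang_loop Gstar"
      by (simp_all add: A Gstar A_normal A_normal_Gs moufang_loop_Gs)
    show "carrier (Gstar Mod A) = carrier Q" "\<one>\<^bsub>Gstar Mod A\<^esub> = \<one>\<^bsub>Q\<^esub>"
      by (simp_all add: Gstar Q A carrier_Gs_Mod)
    show "X \<otimes>\<^bsub>Gstar Mod A\<^esub> Y = X \<otimes>\<^bsub>Q\<^esub> Y" if "X \<in> carrier Q" "Y \<in> carrier Q" for X Y
      using mult_Gs_Mod that unfolding Gstar Q A by blast
    show "associator G x y z = associator Gstar x y z"
      if "x \<in> carrier G" "y \<in> carrier G" "z \<in> carrier G" for x y z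
      using that by (simp add: Gstar associator_Gs)
    show "associator_subloop G = associator_subloop Gstar" "nucleus G = nucleus Gstar"
      by (simp_all add: Gstar associator_subloop_Gs nucleus_Gs)
    show "x \<otimes>\<^bsub>G\<^esub> y = x \<otimes>\<^bsub>Gstar\<^esub> y" if "x \<in> associator_subloop G" "y \<in> associator_subloop G" for x y
      using Gs_mult_S(1)[OF S_closed[OF subsetD[OF S that(1)]] subsetD[OF S that(2)]]
      by (simp add: Gstar)
  qed
qed

end
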